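(* Let $C_0\in\mathbb{R}\setminus\{0\}$, and consider a solution, with $\tilde I_1=C_1$, $\tilde I_2=C_2$, $\tilde I_3=C_3$, $\tilde I_4=C_4=\tfrac12$, of the Hamiltonian system $\dot g=\{g,\tilde H_C\}$ on the phase space $M$ defined in the context. Put $$f(r)=Ar^4+Br^2+C,\qquad A=1-\frac{C_0^2}{4},\quad B=1-C_1+(C_2+C_3)C_0,\quad C=-C_1-(C_2+C_3)^2 .$$ Then the function $r=r(t)$ is given locally (on any time interval on which $\dot r\neq0$), implicitly, by the following formulas, for a suitable constant $t_0\in\mathbb{R}$ and a suitable choice of sign $\pm$ (the same sign wherever $\pm$ occurs in one formula): a) if $A=0$: $$t=t_0\pm\frac{1+a}{\sqrt B}\left(\frac12\sqrt{\frac{1+r^2}{1+a}}\sqrt{\frac{r^2-a}{1+a}}+\frac12\ln\left(\sqrt{\frac{1+r^2}{1+a}}+\sqrt{\frac{r^2-a}{1+a}}\right)\right),\qquad a=-\frac CB;$$ b) if $0<A<1$ and $C=0$: $$t=t_0\pm F(\phi,k)\pm\frac1A\left(\operatorname{dn}u\,\operatorname{sc}u-E(u)\right),\qquad \phi=\operatorname{am}u,\quad \operatorname{sc}u=r,\quad k=\sqrt{1-A};$$ c) if $0<A<1$, $C<0$ and $\pm i$ are roots of $f$, with $\pm\alpha$ ($\alpha>0$) the real roots of $f$: $$t=t_0\pm\sqrt{\frac{r^2-\alpha^2}{A}};$$ d) if $0<A<1$, $C<0$, $\pm\alpha$ ($\alpha>0$) are the real roots and $\pm i\beta$ ($\beta>0$)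 the non-real roots of $f$, and $\beta^2<1$: $$t=t_0\pm\frac{\sqrt{\alpha^2+1}}{\sqrt A}\left(u-E(u)-\operatorname{dn}u\,\operatorname{cs}u\right),\qquad \operatorname{ns}u=\sqrt{\frac{r^2+1}{\alpha^2+1}},\quad k^2=\frac{1-\beta^2}{\alpha^2+1};$$ e) if $0<A<1$, $C<0$, $\pm\alpha$ ($\alpha>0$) are the real roots and $\pm i\beta$ ($\beta>0$) the non-real roots of $f$, and $\beta^2>1$: $$t=t_0\pm\frac{\alpha^2+1}{k'^2\sqrt{A(\alpha^2+\beta^2)}}\left(k'^2u-E(u)+\operatorname{dn}u\,\operatorname{sc}u\right),\qquad \operatorname{nc}u=\sqrt{\frac{r^2+1}{\alpha^2+1}},\quad k'^2=\frac{\alpha^2+1}{\alpha^2+\beta^2};$$ f) if $A<0$ and $\pm\alpha,\pm\beta$ ($0\le\alpha<\beta$) are the real roots of $f$: $$t=t_0\pm\frac{\alpha^2+1}{k'^2\sqrt{|A|(\beta^2+1)}}\left(E(u)-k^2\operatorname{sn}u\,\operatorname{cd}u\right),\qquad \operatorname{nd}u=\sqrt{\frac{r^2+1}{\alpha^2+1}},\quad k'^2=\frac{\alpha^2+1}{\beta^2+1}.$$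
   Context: The system is the reduced geodesic flow (on the level $\lambda_5=C_0\neq 0$ of the momentum conjugate to the central coordinate) of the left-invariant sub-Riemannian metric on the right-invariant contact distribution of the 5-dimensional Heisenberg group, written in hyperspherical coordinates $x_1=r\cos\theta_1\cos\theta_2$, $y_1=r\cos\theta_1\sin\theta_2$, $x_2=r\sin\theta_1\cos\theta_3$, $y_2=r\sin\theta_1\sin\theta_3$ on $\mathbb{R}^4$. Solutions are parametrised by arc length, which is the normalisation $C_4=\tfrac12$. Phase space $M$: points $(r,\theta_1,\theta_2,\theta_3,p_r,p_{\theta_1},p_{\theta_2},p_{\theta_3})$ with $r>0$, $\theta_1\in(0,\pi/2)$, $\theta_2,\theta_3$ angles (mod $2\pi$), and $p_r,p_{\theta_1},p_{\theta_2},p_{\theta_3}\in\mathbb{R}$. Hamiltonian: $$\tilde H_C=\frac12\left[p_r^2+\frac{1}{r^2}p_{\theta_1}^2+\frac1{r^2}\left(\frac{p_{\theta_2}^2}{\cos^2\theta_1}+\frac{p_{\theta_3}^2}{\sin^2\theta_1}\right)-\frac{1}{1+r^2}(p_{\theta_2}+p_{\theta_3})^2\right].$$ Poisson structure (non-canonical): the coordinates $r,\theta_1,\theta_2,\theta_3$ pairwise Poisson-commute, $\{r,p_r\}=1$, $\{r,p_{\theta_k}\}=\{\theta_j,p_r\}=0$, $\{\theta_j,p_{\theta_k}\}=\delta_{jk}$ for $j,k\in\{1,2,3\}$, and $\{p_r,p_{\theta_1}\}=0$, $\{p_r,p_{\theta_2}\}=rC_0\cos^2\theta_1$, $\{p_r,p_{\theta_3}\}=rC_0\sin^2\theta_1$,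 $\{p_{\theta_1},p_{\theta_2}\}=-\{p_{\theta_1},p_{\theta_3}\}=-r^2C_0\sin\theta_1\cos\theta_1$, $\{p_{\theta_2},p_{\theta_3}\}=0$. The Hamiltonian system is $\dot g=\{g,\tilde H_C\}$ for each coordinate function $g$. First integrals (constant along every solution): $\tilde I_1=p_{\theta_1}^2+\dfrac{p_{\theta_2}^2}{\cos^2\theta_1}+\dfrac{p_{\theta_3}^2}{\sin^2\theta_1}-(p_{\theta_2}+p_{\theta_3})^2$, $\tilde I_2=p_{\theta_2}+C_0\dfrac{r^2}{2}\cos^2\theta_1$, $\tilde I_3=p_{\theta_3}+C_0\dfrac{r^2}{2}\sin^2\theta_1$, $\tilde I_4=\tilde H_C$. Elliptic notation: for modulus $k\in[0,1)$ and complementary modulus $k'=\sqrt{1-k^2}$, $F(\phi,k)=\int_0^\phi\frac{dv}{\sqrt{1-k^2\sin^2v}}$, $E(\phi,k)=\int_0^\phi\sqrt{1-k^2\sin^2v}\,dv$; the amplitude $\operatorname{am}u$ is defined by $F(\operatorname{am}u,k)=u$, and $E(u)$ abbreviates $E(\operatorname{am}u,k)$. Jacobi functions of modulus $k$: $\operatorname{sn}u=\sin(\operatorname{am}u)$, $\operatorname{cn}u=\cos(\operatorname{am}u)$, $\operatorname{dn}u=\sqrt{1-k^2\operatorname{sn}^2u}$, and $\operatorname{sc}=\operatorname{sn}/\operatorname{cn}$, $\operatorname{cs}=\operatorname{cn}/\operatorname{sn}$, $\operatorname{ns}=1/\operatorname{sn}$, $\operatorname{nc}=1/\operatorname{cn}$,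 $\operatorname{nd}=1/\operatorname{dn}$, $\operatorname{cd}=\operatorname{cn}/\operatorname{dn}$. In b), d), e), f) the variable $u=u(r)$ is the solution of the indicated equation in $(0,K(k))$, where $K(k)=F(\pi/2,k)$. *)

theory Defs
  imports "HOL-Analysis.Analysis"
begin

section \<open>Phase space, Poisson structure and Hamiltonian system\<close>

text \<open>The coordinates $r, \theta_1, \theta_2, \theta_3, p_r, p_{\theta_1}, p_{\theta_2},
  p_{\theta_3}$, in this order. They index the components of a point of the phase space.\<close>

datatype coord = Rad | Th1 | Th2 | Th3 | PRad | PTh1 | PTh2 | PTh3

instance coord :: finite
proof
  have "(UNIV :: coord set) \<subseteq> {Rad, Th1, Th2, Th3, PRad, PTh1, PTh2, PTh3}"
    using coord.exhaust by blast
  then show "finite (UNIV :: coord set)"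
    by (rule finite_subset) simp
qed

type_synonym point = "real ^ coord"

text \<open>The angles $\theta_2, \theta_3$ (mod $2\pi$) are represented by real numbers: a curve
  parametrised by a time interval is represented by a differentiable lift of its angles.
  Nothing below depends on the lift, since neither the Hamiltonian, nor the brackets, nor the
  first integrals involve $\theta_2$ or $\theta_3$.\<close>

definition phase_space :: "point set" where
  "phase_space = {x. 0 < x $ Rad \<and> 0 < x $ Th1 \<and> x $ Th1 < pi / 2}"

definition hamiltonian :: "point \<Rightarrow> real" where
  "hamiltonian x =
     1 / 2 * ((x $ PRad)\<^sup>2 + 1 / (x $ Rad)\<^sup>2 * (x $ PTh1)\<^sup>2
       + 1 / (x $ Rad)\<^sup>2 * ((x $ PTh2)\<^sup>2 / (cos (x $ Th1))\<^sup>2 + (x $ PTh3)\<^sup>2 / (sin (x $ Th1))\<^sup>2)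
       - 1 / (1 + (x $ Rad)\<^sup>2) * (x $ PTh2 + x $ PTh3)\<^sup>2)"

text \<open>The brackets of coordinate functions that are not zero, one of each antisymmetric pair.\<close>

fun half_bracket :: "real \<Rightarrow> point \<Rightarrow> coord \<Rightarrow> coord \<Rightarrow> real" where
  "half_bracket C0 x Rad PRad = 1"
| "half_bracket C0 x Th1 PTh1 = 1"
| "half_bracket C0 x Th2 PTh2 = 1"
| "half_bracket C0 x Th3 PTh3 = 1"
| "half_bracket C0 x PRad PTh2 = x $ Rad * C0 * (cos (x $ Th1))\<^sup>2"
| "half_bracket C0 x PRad PTh3 = x $ Rad * C0 * (sin (x $ Th1))\<^sup>2"
| "half_bracket C0 x PTh1 PTh2 = - ((x $ Rad)\<^sup>2 * C0 * sin (x $ Th1) * cos (x $ Th1))"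
| "half_bracket C0 x PTh1 PTh3 = (x $ Rad)\<^sup>2 * C0 * sin (x $ Th1) * cos (x $ Th1)"
| "half_bracket C0 x _ _ = 0"

definition coord_bracket :: "real \<Rightarrow> point \<Rightarrow> coord \<Rightarrow> coord \<Rightarrow> real" where
  "coord_bracket C0 x i j = half_bracket C0 x i j - half_bracket C0 x j i"

definition partial_deriv :: "(point \<Rightarrow> real) \<Rightarrow> coord \<Rightarrow> point \<Rightarrow> real" where
  "partial_deriv G i x = deriv (\<lambda>s. G (x + s *\<^sub>R axis i 1)) 0"

definition poisson :: "real \<Rightarrow> (point \<Rightarrow> real) \<Rightarrow> (point \<Rightarrow> real) \<Rightarrow> point \<Rightarrow> real" where
  "poisson C0 G H x =
     (\<Sum>i\<in>UNIV. \<Sum>j\<in>UNIV. partial_deriv G i x * partial_deriv H j x * coord_bracket C0 x i j)"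

definition hamiltonian_solution :: "real \<Rightarrow> real set \<Rightarrow> (real \<Rightarrow> point) \<Rightarrow> bool" where
  "hamiltonian_solution C0 J \<gamma> \<longleftrightarrow>
     (\<forall>t\<in>J. \<gamma> t \<in> phase_space \<and>
       (\<forall>i. ((\<lambda>s. \<gamma> s $ i) has_real_derivative poisson C0 (\<lambda>x. x $ i) hamiltonian (\<gamma> t)) (at t)))"

definition integral1 :: "point \<Rightarrow> real" where
  "integral1 x = (x $ PTh1)\<^sup>2 + (x $ PTh2)\<^sup>2 / (cos (x $ Th1))\<^sup>2 + (x $ PTh3)\<^sup>2 / (sin (x $ Th1))\<^sup>2
     - (x $ PTh2 + x $ PTh3)\<^sup>2"

definition integral2 :: "real \<Rightarrow> point \<Rightarrow> real" where
  "integral2 C0 x = x $ PTh2 + C0 * (x $ Rad)\<^sup>2 / 2 * (cos (x $ Th1))\<^sup>2"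

definition integral3 :: "real \<Rightarrow> point \<Rightarrow> real" where
  "integral3 C0 x = x $ PTh3 + C0 * (x $ Rad)\<^sup>2 / 2 * (sin (x $ Th1))\<^sup>2"

abbreviation integral4 :: "point \<Rightarrow> real" where
  "integral4 \<equiv> hamiltonian"

text \<open>The polynomial $f$, usable at real and at complex arguments.\<close>

definition quartic :: "real \<Rightarrow> real \<Rightarrow> real \<Rightarrow> 'a::real_algebra_1 \<Rightarrow> 'a" where
  "quartic A B C z = of_real A * z ^ 4 + of_real B * z\<^sup>2 + of_real C"


section \<open>Elliptic integrals and Jacobi functions\<close>

text \<open>The modulus \<open>k\<close> is the last argument throughout. The integrals are oriented, hence
  defined for amplitudes of either sign.\<close>

definition ellF :: "real \<Rightarrow> real \<Rightarrow> real" where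
  "ellF \<phi> k = (LBINT v=0..\<phi>. 1 / sqrt (1 - k\<^sup>2 * (sin v)\<^sup>2))"

definition ellE :: "real \<Rightarrow> real \<Rightarrow> real" where
  "ellE \<phi> k = (LBINT v=0..\<phi>. sqrt (1 - k\<^sup>2 * (sin v)\<^sup>2))"

definition ellK :: "real \<Rightarrow> real" where
  "ellK k = ellF (pi / 2) k"

text \<open>For \<open>0 \<le> k < 1\<close> the map \<open>\<lambda>\<phi>. ellF \<phi> k\<close> is an increasing bijection of the real line,
  so the description below denotes a unique real number.\<close>

definition am :: "real \<Rightarrow> real \<Rightarrow> real" where
  "am u k = (THE \<phi>. ellF \<phi> k = u)"

text \<open>The abbreviation $E(u) = E(\mathrm{am}\,u, k)$.\<close>

definition jacobi_E :: "real \<Rightarrow> real \<Rightarrow> real" where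
  "jacobi_E u k = ellE (am u k) k"

definition sn :: "real \<Rightarrow> real \<Rightarrow> real" where "sn u k = sin (am u k)"
definition cn :: "real \<Rightarrow> real \<Rightarrow> real" where "cn u k = cos (am u k)"
definition dn :: "real \<Rightarrow> real \<Rightarrow> real" where "dn u k = sqrt (1 - k\<^sup>2 * (sn u k)\<^sup>2)"
definition sc :: "real \<Rightarrow> real \<Rightarrow> real" where "sc u k = sn u k / cn u k"
definition cs :: "real \<Rightarrow> real \<Rightarrow> real" where "cs u k = cn u k / sn u k"
definition ns :: "real \<Rightarrow> real \<Rightarrow> real" where "ns u k = 1 / sn u k"
definition nc :: "real \<Rightarrow> real \<Rightarrow> real" where "nc u k = 1 / cn u k"
definition nd :: "real \<Rightarrow> real \<Rightarrow> real" where "nd u k = 1 / dn u k"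
definition cd :: "real \<Rightarrow> real \<Rightarrow> real" where "cd u k = cn u k / dn u k"

definition compl_modulus :: "real \<Rightarrow> real" where
  "compl_modulus k = sqrt (1 - k\<^sup>2)"

text \<open>``\<open>u\<close> is the solution of the equation \<open>g u = y\<close> in \<open>(0, K(k))\<close>'': existence and uniqueness
  are part of the predicate.\<close>

definition is_the_solution :: "(real \<Rightarrow> real) \<Rightarrow> real \<Rightarrow> real \<Rightarrow> real \<Rightarrow> bool" where
  "is_the_solution g y k u \<longleftrightarrow> (\<forall>v. v \<in> {0<..<ellK k} \<and> g v = y \<longleftrightarrow> v = u)"

end

theory Submission
  imports Defs
begin

text \<open>The bracket of \<open>r\<close> with the Hamiltonian is \<open>p\<^sub>r\<close>, so \<open>r' = p\<^sub>r\<close>. The second and the third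
  integral give \<open>p\<^sub>\<theta>\<^sub>2 + p\<^sub>\<theta>\<^sub>3 = C\<^sub>2 + C\<^sub>3 - C\<^sub>0 r\<^sup>2 / 2\<close>, and with the first integral the angular part of the
  energy becomes a function of \<open>r\<close> alone. On the level \<open>1 / 2\<close> this is the radial equation
  \<open>r\<^sup>2 (1 + r\<^sup>2) r'\<^sup>2 = f r\<close> (\<open>radial_equation\<close>).

  Each formula has the shape \<open>t = t\<^sub>0 + \<sigma> \<Phi> (r t)\<close>. For a \<open>\<Phi>\<close> whose derivative has constant sign and
  satisfies \<open>(\<Phi>' r)\<^sup>2 f r = r\<^sup>2 (1 + r\<^sup>2)\<close>, the composite \<open>\<Phi> \<circ> r\<close> has derivative \<open>1\<close> or \<open>-1\<close>, the same
  at all times because \<open>r'\<close> is continuous and has no zero (\<open>time_law\<close>). What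
  remains is to check that each of the given functions is, up to sign, a primitive of
  \<open>r sqrt (1 + r\<^sup>2) / sqrt (f r)\<close>.

  In the elliptic cases the amplitude \<open>\<phi> = am u\<close> serves as the variable instead of \<open>u\<close>. Then
  \<open>u\<close> is \<open>ellF \<phi> k\<close>, the Jacobi functions at \<open>u\<close> are elementary functions of \<open>\<phi>\<close>, and in each of these
  cases the equation that defines \<open>u\<close> says that \<open>sin\<^sup>2 \<phi> = (p r\<^sup>2 + q) / (1 + r\<^sup>2)\<close> for suitable
  constants \<open>p\<close> and \<open>q\<close>. So one change of variables (\<open>elliptic_time_law\<close>) treats them all, and up to
  constant factors \<open>\<Phi>\<close> is a primitive of \<open>ns\<^sup>2\<close>, \<open>nc\<^sup>2\<close> or \<open>nd\<^sup>2\<close> with respect to \<open>u\<close>. The roots of \<open>f\<close>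
  enter only through the coefficients that they determine. Where the roots are not prescribed,
  \<open>C\<^sub>1 \<ge> 0\<close> (\<open>integral1_nonneg\<close>) supplies the missing information: it gives \<open>C \<le> 0\<close>, and when
  \<open>C = 0\<close> it forces \<open>C\<^sub>1 = C\<^sub>2 + C\<^sub>3 = 0\<close> and hence \<open>B = 1\<close>.\<close>

section \<open>Elliptic integrals and the amplitude\<close>

lemma Delta_pos:
  fixes k x :: real
  assumes "0 \<le> k" "k < 1"
  shows "0 < 1 - k\<^sup>2 * (sin x)\<^sup>2"
proof -
  have "(sin x)\<^sup>2 \<le> 1" by (simp add: abs_square_le_1)
  moreover have "k\<^sup>2 < 1" using assms by (simp add: power_less_one_iff)
  ultimately have "k\<^sup>2 * (sin x)\<^sup>2 < 1"
    by (smt (verit) mult_left_le zero_le_power2)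
  then show ?thesis by simp
qed

lemma DERIV_oriented_integral:
  fixes f :: "real \<Rightarrow> real"
  assumes "continuous_on UNIV f"
  shows "((\<lambda>x. LBINT v=0..ereal x. f v) has_real_derivative f x) (at x)"
proof -
  let ?a = "- \<bar>x\<bar> - 1" and ?b = "\<bar>x\<bar> + 1"
  have "((\<lambda>u. LBINT y=ereal 0..ereal u. f y) has_vector_derivative f x) (at x within {?a..?b})"
    by (rule interval_integral_FTC2) (auto intro: continuous_on_subset[OF assms])
  moreover have "at x within {?a..?b} = at x"
    by (rule at_within_interior) (auto simp: abs_if)
  ultimately show ?thesis
    by (simp add: has_real_derivative_iff_has_vector_derivative zero_ereal_def)
qed

lemma DERIV_ellF:
  assumes "0 \<le> k" "k < 1"
  shows "((\<lambda>x. ellF x k) has_real_derivative 1 / sqrt (1 - k\<^sup>2 * (sin x)\<^sup>2)) (at x)"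
  unfolding ellF_def
  by (rule DERIV_oriented_integral)
     (use Delta_pos[OF assms] in \<open>auto intro!: continuous_intros simp: less_imp_neq[symmetric]\<close>)

lemma DERIV_ellE:
  shows "((\<lambda>x. ellE x k) has_real_derivative sqrt (1 - k\<^sup>2 * (sin x)\<^sup>2)) (at x)"
  unfolding ellE_def
  by (rule DERIV_oriented_integral) (auto intro!: continuous_intros)

lemma ellF_strict_mono:
  assumes "0 \<le> k" "k < 1"
  shows "strict_mono (\<lambda>x. ellF x k)"
proof (rule strict_monoI)
  fix x y :: real
  assume "x < y"
  then show "ellF x k < ellF y k"
    by (rule DERIV_pos_imp_increasing) (use DERIV_ellF[OF assms] Delta_pos[OF assms] in fastforce)
qed

lemma ellF_0: "ellF 0 k = 0"
  by (simp add: ellF_def zero_ereal_def)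

lemma am_ellF:
  assumes "0 \<le> k" "k < 1"
  shows "am (ellF \<phi> k) k = \<phi>"
  unfolding am_def using strict_mono_eq[OF ellF_strict_mono[OF assms]] by auto

text \<open>Since \<open>ellF\<close> increases continuously from \<open>0\<close> to \<open>K(k)\<close> on the first quadrant, amplitudes there
  are a faithful substitute for the arguments \<open>u\<close> of the Jacobi functions.\<close>

lemma in_quarter_period_iff:
  assumes "0 \<le> k" "k < 1"
  shows "v \<in> {0<..<ellK k} \<longleftrightarrow> (\<exists>\<psi>. 0 < \<psi> \<and> \<psi> < pi / 2 \<and> v = ellF \<psi> k)"
proof
  assume v: "v \<in> {0<..<ellK k}"
  have "\<exists>\<psi>\<ge>0. \<psi> \<le> pi / 2 \<and> ellF \<psi> k = v"
    by (rule IVT) (use v DERIV_isCont[OF DERIV_ellF[OF assms]] in \<open>auto simp: ellF_0 ellK_def\<close>)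
  then obtain \<psi> where \<psi>: "0 \<le> \<psi>" "\<psi> \<le> pi / 2" "ellF \<psi> k = v"
    by blast
  with v have "ellF \<psi> k \<noteq> ellF 0 k" "ellF \<psi> k \<noteq> ellF (pi / 2) k"
    by (auto simp: ellF_0 ellK_def)
  then have "\<psi> \<noteq> 0" "\<psi> \<noteq> pi / 2" by blast+
  with \<psi> show "\<exists>\<psi>. 0 < \<psi> \<and> \<psi> < pi / 2 \<and> v = ellF \<psi> k"
    by (intro exI[of _ \<psi>]) auto
next
  assume "\<exists>\<psi>. 0 < \<psi> \<and> \<psi> < pi / 2 \<and> v = ellF \<psi> k"
  then show "v \<in> {0<..<ellK k}"
    using strict_monoD[OF ellF_strict_mono[OF assms]] ellF_0[of k]
    by (metis ellK_def greaterThanLessThan_iff)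
qed

text \<open>In the first quadrant the amplitude is determined by the square of its sine, so unique solvability
  of an equation for \<open>u\<close> reduces to rewriting that equation as a condition on \<open>sin\<^sup>2 \<psi>\<close>.\<close>

lemma is_the_solution_ellF:
  assumes k: "0 \<le> k" "k < 1" and \<phi>: "0 < \<phi>" "\<phi> < pi / 2"
    and g: "\<And>\<psi>. 0 < \<psi> \<Longrightarrow> \<psi> < pi / 2 \<Longrightarrow> g (ellF \<psi> k) = y \<longleftrightarrow> (sin \<psi>)\<^sup>2 = (sin \<phi>)\<^sup>2"
  shows "is_the_solution g y k (ellF \<phi> k)"
proof -
  have "\<psi> = \<phi>" if "0 < \<psi>" "\<psi> < pi / 2" "(sin \<psi>)\<^sup>2 = (sin \<phi>)\<^sup>2" for \<psi>
  proof -
    have "0 < sin \<psi>" "0 < sin \<phi>" using that \<phi> by (auto intro: sin_gt_zero)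
    then have "sin \<psi> = sin \<phi>" using that by (simp add: power2_eq_iff_nonneg)
    then show ?thesis by (rule sin_inj_pi[rotated 4]) (use that \<phi> in auto)
  qed
  then show ?thesis
    unfolding is_the_solution_def in_quarter_period_iff[OF k] using g \<phi> by blast
qed

text \<open>The equations for \<open>ns\<close>, \<open>nc\<close> and \<open>nd\<close> all equate a reciprocal with a square root.\<close>

lemma inverse_eq_sqrt_iff:
  fixes y z :: real
  assumes "0 < y"
  shows "1 / y = sqrt z \<longleftrightarrow> y\<^sup>2 = 1 / z"
proof
  assume "1 / y = sqrt z"
  moreover have "0 < 1 / y" using assms by simp
  ultimately have "z = (1 / y)\<^sup>2" by (metis real_sqrt_gt_0_iff less_imp_le real_sqrt_pow2)
  then show "y\<^sup>2 = 1 / z" by (simp add: power_divide)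
next
  assume "y\<^sup>2 = 1 / z"
  then have "z = (1 / y)\<^sup>2" using assms by (simp add: power_divide)
  then show "1 / y = sqrt z" using assms by (simp add: real_sqrt_unique)
qed

lemma jacobi_at_ellF:
  assumes "0 \<le> k" "k < 1"
  shows "sn (ellF \<phi> k) k = sin \<phi>" "cn (ellF \<phi> k) k = cos \<phi>"
    "dn (ellF \<phi> k) k = sqrt (1 - k\<^sup>2 * (sin \<phi>)\<^sup>2)" "jacobi_E (ellF \<phi> k) k = ellE \<phi> k"
  by (simp_all add: sn_def cn_def dn_def jacobi_E_def am_ellF[OF assms])

lemma DERIV_Delta:
  assumes "0 \<le> k" "k < 1"
  shows "((\<lambda>x. sqrt (1 - k\<^sup>2 * (sin x)\<^sup>2)) has_real_derivative
    - (k\<^sup>2 * sin x * cos x) / sqrt (1 - k\<^sup>2 * (sin x)\<^sup>2)) (at x)"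
  using Delta_pos[OF assms, of x]
  by (auto intro!: derivative_eq_intros simp: field_simps)

text \<open>As \<open>du = d\<phi> / dn\<close>, the next three derivatives, taken with respect to the amplitude, are the
  classical integrals of \<open>ns\<^sup>2\<close>, \<open>nc\<^sup>2\<close> and \<open>nd\<^sup>2\<close> with respect to \<open>u\<close>, the last two multiplied by \<open>k'\<^sup>2\<close>.
  With \<open>D = dn\<close>, each reduces to polynomial identities modulo \<open>cos\<^sup>2 = 1 - sin\<^sup>2\<close> and
  \<open>D\<^sup>2 = 1 - k\<^sup>2 sin\<^sup>2\<close>.\<close>

lemma DERIV_ns_squared_primitive:
  assumes k: "0 \<le> k" "k < 1" and x: "0 < x" "x < pi / 2"
  shows "((\<lambda>x. ellF x k - ellE x k - sqrt (1 - k\<^sup>2 * (sin x)\<^sup>2) * (cos x / sin x)) has_real_derivative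
    1 / ((sin x)\<^sup>2 * sqrt (1 - k\<^sup>2 * (sin x)\<^sup>2))) (at x)"
proof -
  define D where "D = sqrt (1 - k\<^sup>2 * (sin x)\<^sup>2)"
  have D: "D > 0" "D\<^sup>2 = 1 - k\<^sup>2 * (sin x)\<^sup>2" using Delta_pos[OF k, of x] by (auto simp: D_def)
  have s: "sin x > 0" using x by (auto intro: sin_gt_zero)
  have c: "(cos x)\<^sup>2 = 1 - (sin x)\<^sup>2" by (simp add: cos_squared_eq)
  have cc: "cos x * cos x = 1 - sin x * sin x" and DD: "D * D = 1 - k * k * (sin x * sin x)"
    using c D(2) by (simp_all add: power2_eq_square)
  have "1 / D - D - (- (k\<^sup>2 * sin x * cos x) / D * (cos x / sin x)
      + (- sin x * sin x - cos x * cos x) / (sin x * sin x) * D) = 1 / ((sin x)\<^sup>2 * D)"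
    using D(1) s by (simp add: divide_simps power2_eq_square) (use cc DD in algebra)
  note eq = this[unfolded D_def]
  show ?thesis
    by (rule DERIV_cong[OF DERIV_diff[OF DERIV_diff[OF DERIV_ellF[OF k] DERIV_ellE]
            DERIV_mult[OF DERIV_Delta[OF k] DERIV_divide[OF DERIV_cos DERIV_sin]]]])
       (fact eq | use s in simp)+
qed

lemma DERIV_nc_squared_primitive:
  assumes k: "0 \<le> k" "k < 1" and x: "0 < x" "x < pi / 2"
  shows "((\<lambda>x. (1 - k\<^sup>2) * ellF x k - ellE x k + sqrt (1 - k\<^sup>2 * (sin x)\<^sup>2) * (sin x / cos x)) has_real_derivative
    (1 - k\<^sup>2) / ((cos x)\<^sup>2 * sqrt (1 - k\<^sup>2 * (sin x)\<^sup>2))) (at x)"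
proof -
  define D where "D = sqrt (1 - k\<^sup>2 * (sin x)\<^sup>2)"
  have D: "D > 0" "D\<^sup>2 = 1 - k\<^sup>2 * (sin x)\<^sup>2" using Delta_pos[OF k, of x] by (auto simp: D_def)
  have s: "cos x > 0" using x by (auto intro: cos_gt_zero_pi)
  have c: "(cos x)\<^sup>2 = 1 - (sin x)\<^sup>2" by (simp add: cos_squared_eq)
  have cc: "cos x * cos x = 1 - sin x * sin x" and DD: "D * D = 1 - k * k * (sin x * sin x)"
    using c D(2) by (simp_all add: power2_eq_square)
  have "(1 - k\<^sup>2) * (1 / D) - D + (- (k\<^sup>2 * sin x * cos x) / D * (sin x / cos x)
      + (cos x * cos x - sin x * - sin x) / (cos x * cos x) * D) = (1 - k\<^sup>2) / ((cos x)\<^sup>2 * D)"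
    using D(1) s by (simp add: divide_simps power2_eq_square) (use cc DD in algebra)
  note eq = this[unfolded D_def]
  show ?thesis
    by (rule DERIV_cong[OF DERIV_add[OF DERIV_diff[OF DERIV_cmult[OF DERIV_ellF[OF k]] DERIV_ellE]
            DERIV_mult[OF DERIV_Delta[OF k] DERIV_divide[OF DERIV_sin DERIV_cos]]]])
       (fact eq | use s in simp)+
qed

lemma DERIV_nd_squared_primitive:
  assumes k: "0 \<le> k" "k < 1"
  shows "((\<lambda>x. ellE x k - k\<^sup>2 * (sin x * (cos x / sqrt (1 - k\<^sup>2 * (sin x)\<^sup>2)))) has_real_derivative
    (1 - k\<^sup>2) / (sqrt (1 - k\<^sup>2 * (sin x)\<^sup>2)) ^ 3) (at x)"
proof -
  define D where "D = sqrt (1 - k\<^sup>2 * (sin x)\<^sup>2)"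
  have D: "D > 0" "D\<^sup>2 = 1 - k\<^sup>2 * (sin x)\<^sup>2" using Delta_pos[OF k, of x] by (auto simp: D_def)
  have c: "(cos x)\<^sup>2 = 1 - (sin x)\<^sup>2" by (simp add: cos_squared_eq)
  have cc: "cos x * cos x = 1 - sin x * sin x" and DD: "D * D = 1 - k * k * (sin x * sin x)"
    using c D(2) by (simp_all add: power2_eq_square)
  have "D - k\<^sup>2 * (cos x * (cos x / D) + (- sin x * D - cos x * (- (k\<^sup>2 * sin x * cos x) / D)) / (D * D) * sin x)
     = (1 - k\<^sup>2) / D ^ 3"
    using D(1) by (simp add: divide_simps power2_eq_square power3_eq_cube) (use cc DD in algebra)
  note eq = this[unfolded D_def]
  show ?thesis
    by (rule DERIV_cong[OF DERIV_diff[OF DERIV_ellE DERIV_cmult[OF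
            DERIV_mult[OF DERIV_sin DERIV_divide[OF DERIV_cos DERIV_Delta[OF k]]]]]])
       (fact eq | use D(1) in \<open>simp add: D_def\<close>)+
qed

section \<open>The radial equation\<close>

lemma UNIV_coord: "UNIV = {Rad, Th1, Th2, Th3, PRad, PTh1, PTh2, PTh3}"
  using coord.exhaust by auto

lemma poisson_Rad_hamiltonian:
  "poisson C0 (\<lambda>x. x $ Rad) hamiltonian x = x $ PRad"
proof -
  have 1: "partial_deriv (\<lambda>x. x $ Rad) i x = (if i = Rad then 1 else 0)" for i
  proof -
    have "((\<lambda>s. (x + s *\<^sub>R axis i 1) $ Rad) has_real_derivative (if i = Rad then 1 else 0)) (at 0)"
      by (auto intro!: derivative_eq_intros simp: axis_def)
    then show ?thesis unfolding partial_deriv_def by (rule DERIV_imp_deriv)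
  qed
  have 2: "partial_deriv hamiltonian PRad x = x $ PRad"
    unfolding partial_deriv_def hamiltonian_def
    by (rule DERIV_imp_deriv) (auto intro!: derivative_eq_intros simp: axis_def)
  show ?thesis
    unfolding poisson_def
    by (simp add: UNIV_coord 1 2 coord_bracket_def)
qed

text \<open>This is the Cauchy-Schwarz inequality for \<open>(p\<^sub>\<theta>\<^sub>2 / cos \<theta>\<^sub>1, p\<^sub>\<theta>\<^sub>3 / sin \<theta>\<^sub>1)\<close> and the unit vector
  \<open>(cos \<theta>\<^sub>1, sin \<theta>\<^sub>1)\<close>, with the defect exhibited as a square.\<close>

lemma integral1_nonneg:
  assumes "x \<in> phase_space"
  shows "0 \<le> integral1 x"
proof -
  define a b c s where abcs: "a = x $ PTh2" "b = x $ PTh3" "c = cos (x $ Th1)" "s = sin (x $ Th1)"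
  have pos: "c > 0" "s > 0"
    using assms by (auto simp: abcs phase_space_def intro: cos_gt_zero_pi sin_gt_zero)
  have cs: "c * c + s * s = 1" by (simp add: abcs flip: power2_eq_square)
  have "a\<^sup>2 / c\<^sup>2 + b\<^sup>2 / s\<^sup>2 - (a + b)\<^sup>2 = (a * s / c - b * c / s)\<^sup>2"
    using pos by (simp add: divide_simps power2_eq_square) (use cs in algebra)
  then have "integral1 x = (x $ PTh1)\<^sup>2 + (a * s / c - b * c / s)\<^sup>2"
    by (simp add: integral1_def abcs)
  then show ?thesis by simp
qed

text \<open>With \<open>P = p\<^sub>\<theta>\<^sub>2 + p\<^sub>\<theta>\<^sub>3\<close>, the energy is \<open>p\<^sub>r\<^sup>2 + (I\<^sub>1 + P\<^sup>2) / r\<^sup>2 - P\<^sup>2 / (1 + r\<^sup>2)\<close> up to the factor \<open>1 / 2\<close>, and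
  \<open>P = S - C\<^sub>0 r\<^sup>2 / 2\<close> because the squares of \<open>cos \<theta>\<^sub>1\<close> and \<open>sin \<theta>\<^sub>1\<close> in the second and third integral
  add up to \<open>1\<close>.\<close>

lemma radial_equation:
  fixes C0 :: real
  assumes "x \<in> phase_space" "hamiltonian x = 1 / 2"
  defines "S \<equiv> integral2 C0 x + integral3 C0 x"
  shows "(x $ Rad)\<^sup>2 * (1 + (x $ Rad)\<^sup>2) * (x $ PRad)\<^sup>2 =
    quartic (1 - C0\<^sup>2 / 4) (1 - integral1 x + S * C0) (- integral1 x - S\<^sup>2) (x $ Rad)"
proof -
  define P where "P = x $ PTh2 + x $ PTh3"
  define r where "r = x $ Rad"
  have r: "r > 0" using assms by (simp add: phase_space_def r_def)
  have "S = P + C0 * r\<^sup>2 / 2 * ((cos (x $ Th1))\<^sup>2 + (sin (x $ Th1))\<^sup>2)"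
    by (simp only: S_def P_def r_def integral2_def integral3_def ring_distribs)
  then have S: "S = P + C0 * r\<^sup>2 / 2" by simp
  have regroup: "2 * (1 / 2 * (a + 1 / R * b + 1 / R * (c + d) - 1 / Q * e)) =
      a + (b + c + d - e + e) / R - e / Q" for a b c d e R Q :: real
    by (simp add: add_divide_distrib ring_distribs)
  have "2 * hamiltonian x = (x $ PRad)\<^sup>2 + (integral1 x + P\<^sup>2) / r\<^sup>2 - P\<^sup>2 / (1 + r\<^sup>2)"
    unfolding hamiltonian_def integral1_def P_def[symmetric] r_def[symmetric] by (rule regroup)
  then have "(x $ PRad)\<^sup>2 = 1 - (integral1 x + P\<^sup>2) / r\<^sup>2 + P\<^sup>2 / (1 + r\<^sup>2)"
    using assms by simp
  moreover have "r\<^sup>2 * (1 + r\<^sup>2) * (1 - (integral1 x + P\<^sup>2) / r\<^sup>2 + P\<^sup>2 / (1 + r\<^sup>2)) =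
     r\<^sup>2 * (1 + r\<^sup>2) - (integral1 x + P\<^sup>2) * (1 + r\<^sup>2) + P\<^sup>2 * r\<^sup>2"
  proof -
    have "1 + r\<^sup>2 \<noteq> 0" by (smt (verit) zero_le_power2)
    then show ?thesis using r by (simp add: divide_simps) algebra
  qed
  ultimately show ?thesis
    by (simp add: quartic_def S r_def[symmetric]) (simp add: field_simps power2_eq_square power4_eq_xxxx)
qed

section \<open>From a primitive to the time law\<close>

lemma constant_sign_on_interval:
  fixes v :: "real \<Rightarrow> real"
  assumes "is_interval T" "continuous_on T v" "\<And>t. t \<in> T \<Longrightarrow> v t \<noteq> 0"
  obtains \<tau> where "\<tau> \<in> {1, -1}" "\<And>t. t \<in> T \<Longrightarrow> 0 < \<tau> * v t"
proof -
  have c: "is_interval (v ` T)"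
    using assms connected_continuous_image is_interval_connected_1 by blast
  have "\<not> (a < 0 \<and> 0 < b)" if "a \<in> v ` T" "b \<in> v ` T" for a b
    using mem_is_interval_1_I[OF c that, of 0] assms(3) by force
  then have "(\<forall>t\<in>T. v t > 0) \<or> (\<forall>t\<in>T. v t < 0)"
    using assms(3) by (metis imageI linorder_neqE_linordered_idom)
  then show thesis using that[of 1] that[of "-1"] by auto
qed

lemma DERIV_sqrt_of:
  fixes S :: "real \<Rightarrow> real"
  assumes "(S has_real_derivative 2 * d) (at x)" "0 < S x"
  shows "((\<lambda>x. sqrt (S x)) has_real_derivative d / sqrt (S x)) (at x)"
  by (rule DERIV_cong[OF DERIV_chain2[OF DERIV_real_sqrt[OF assms(2)] assms(1)]])
     (use assms(2) in \<open>simp add: field_simps\<close>)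

text \<open>The amplitude \<open>am u\<close> as a function of \<open>r\<close>, for every elliptic case at once: in each of them the
  equation for \<open>u\<close> makes \<open>sn\<^sup>2 u\<close> the quotient of an affine function of \<open>r\<^sup>2\<close> by \<open>1 + r\<^sup>2\<close>.\<close>

definition amplitude :: "real \<Rightarrow> real \<Rightarrow> real \<Rightarrow> real" where
  "amplitude p q x = arcsin (sqrt ((p * x\<^sup>2 + q) / (1 + x\<^sup>2)))"

lemma amplitude_props:
  assumes "0 < p * x\<^sup>2 + q" "p * x\<^sup>2 + q < 1 + x\<^sup>2"
  shows "0 < amplitude p q x" "amplitude p q x < pi / 2"
    "(sin (amplitude p q x))\<^sup>2 = (p * x\<^sup>2 + q) / (1 + x\<^sup>2)"
    "(cos (amplitude p q x))\<^sup>2 = 1 - (p * x\<^sup>2 + q) / (1 + x\<^sup>2)"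
proof -
  define S where "S = (p * x\<^sup>2 + q) / (1 + x\<^sup>2)"
  have "1 + x\<^sup>2 > 0" by (smt (verit) zero_le_power2)
  then have S: "0 < S" "S < 1" using assms by (simp_all add: S_def)
  then have "0 < sqrt S" "sqrt S < 1" by auto
  then have sq: "0 < sqrt S" "sqrt S < 1" "-1 < sqrt S" by linarith+
  have phi: "amplitude p q x = arcsin (sqrt S)" by (simp add: amplitude_def S_def)
  show "0 < amplitude p q x" "amplitude p q x < pi / 2"
    unfolding phi using sq arcsin_less_arcsin[of 0 "sqrt S"] arcsin_lt_bounded[of "sqrt S"] by auto
  have "sin (amplitude p q x) = sqrt S" unfolding phi using sq by simp
  then show sin: "(sin (amplitude p q x))\<^sup>2 = S" using S by simp
  then show "(cos (amplitude p q x))\<^sup>2 = 1 - S" by (simp add: cos_squared_eq)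
qed

lemma DERIV_amplitude:
  assumes "0 < p * x\<^sup>2 + q" "p * x\<^sup>2 + q < 1 + x\<^sup>2"
  defines "\<phi> \<equiv> amplitude p q x"
  shows "(amplitude p q has_real_derivative
    (p - q) * x / ((1 + x\<^sup>2)\<^sup>2 * (sin \<phi> * cos \<phi>))) (at x)"
proof -
  define S where "S = (\<lambda>x. (p * x\<^sup>2 + q) / (1 + x\<^sup>2))"
  have x1: "1 + y\<^sup>2 > 0" for y :: real by (smt (verit) zero_le_power2)
  then have S: "0 < S x" "S x < 1" using assms by (simp_all add: S_def)
  then have "0 < sqrt (S x)" "sqrt (S x) < 1" by auto
  then have sq: "0 < sqrt (S x)" "sqrt (S x) < 1" "-1 < sqrt (S x)" by linarith+
  have Sx: "S x = (p * x\<^sup>2 + q) / (1 + x\<^sup>2)" by (simp add: S_def)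
  have sin: "sin \<phi> = sqrt (S x)"
    using sq by (simp add: \<phi>_def amplitude_def Sx[symmetric])
  have cos: "cos \<phi> = sqrt (1 - (sqrt (S x))\<^sup>2)"
    using sq by (simp add: \<phi>_def amplitude_def Sx[symmetric] cos_arcsin)
  have pos: "sin \<phi> > 0" "cos \<phi> > 0" using S by (auto simp: sin cos)
  have dS: "(S has_real_derivative 2 * (p - q) * x / (1 + x\<^sup>2)\<^sup>2) (at x)"
    unfolding S_def using x1[of x]
    by (auto intro!: derivative_eq_intros simp: power2_eq_square field_simps)
  have d: "((\<lambda>y. arcsin (sqrt (S y))) has_real_derivative
     inverse (sqrt (1 - (sqrt (S x))\<^sup>2)) * (inverse (sqrt (S x)) / 2 * (2 * (p - q) * x / (1 + x\<^sup>2)\<^sup>2))) (at x)"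
    by (rule DERIV_chain2[OF DERIV_arcsin DERIV_chain2[OF DERIV_real_sqrt dS]]) (use sq S in auto)
  have cos': "cos \<phi> = sqrt (1 - (sin \<phi>)\<^sup>2)" using cos sin by simp
  note d' = d[unfolded sin[symmetric], unfolded cos'[symmetric]]
  have "inverse (cos \<phi>) * (inverse (sin \<phi>) / 2 * (2 * (p - q) * x / y)) =
     (p - q) * x / (y * (sin \<phi> * cos \<phi>))" for y
    using pos by (simp add: divide_simps)
  from DERIV_cong[OF d' this] show ?thesis
    unfolding amplitude_def[abs_def] S_def .
qed

text \<open>The rest of the argument concerns only the scalar function \<open>r\<close> and its velocity \<open>v\<close>, which
  are related by the radial equation.\<close>

locale radial_motion =
  fixes T :: "real set" and r v :: "real \<Rightarrow> real" and A B C :: real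
  assumes T: "is_interval T"
    and r: "\<And>t. t \<in> T \<Longrightarrow> (r has_real_derivative v t) (at t)"
    and v: "continuous_on T v" "\<And>t. t \<in> T \<Longrightarrow> v t \<noteq> 0"
    and pos: "\<And>t. t \<in> T \<Longrightarrow> 0 < r t"
    and energy: "\<And>t. t \<in> T \<Longrightarrow> (r t)\<^sup>2 * (1 + (r t)\<^sup>2) * (v t)\<^sup>2 = quartic A B C (r t)"
begin

lemma quartic_pos:
  assumes "t \<in> T"
  shows "0 < A * (r t) ^ 4 + B * (r t)\<^sup>2 + C"
proof -
  have "0 < 1 + (r t)\<^sup>2" by (smt (verit) zero_le_power2)
  then have "0 < (r t)\<^sup>2 * (1 + (r t)\<^sup>2) * (v t)\<^sup>2"
    using pos[OF assms] v(2)[OF assms] by simp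
  then show ?thesis using energy[OF assms] by (simp add: quartic_def)
qed

text \<open>The chain rule and the last hypothesis give \<open>\<Phi> \<circ> r\<close> a derivative of modulus \<open>1\<close>. Its sign is the
  product of the constant signs \<open>s\<close> of \<open>\<Phi>'\<close> and \<open>\<tau>\<close> of the velocity. Stating the hypothesis
  for squares keeps the square roots of the radial equation out of all applications.\<close>

lemma time_law:
  assumes \<Phi>: "\<And>t. t \<in> T \<Longrightarrow> (\<Phi> has_real_derivative D (r t)) (at (r t))"
    and s: "s \<in> {1, -1}" "\<And>t. t \<in> T \<Longrightarrow> 0 < s * D (r t)"
    and D: "\<And>t. t \<in> T \<Longrightarrow> (D (r t))\<^sup>2 * (v t)\<^sup>2 = 1"
  shows "\<exists>t0. \<exists>\<sigma>\<in>{1, -1}. \<forall>t\<in>T. t = t0 + \<sigma> * \<Phi> (r t)"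
proof -
  obtain \<tau> where \<tau>: "\<tau> \<in> {1, -1}" "\<And>t. t \<in> T \<Longrightarrow> 0 < \<tau> * v t"
    using constant_sign_on_interval[OF T v] by blast
  \<comment> \<open>The candidate for the derivative of \<open>\<Phi> \<circ> r\<close>; being its own inverse, it is also the sign in the formula.\<close>
  define \<sigma> where "\<sigma> = s * \<tau>"
  have \<sigma>: "\<sigma> \<in> {1, -1}" "\<sigma> * \<sigma> = 1" using s \<tau> by (auto simp: \<sigma>_def)
  have speed: "D (r t) * v t = \<sigma>" if "t \<in> T" for t
  proof -
    have "0 < \<sigma> * (D (r t) * v t)"
      using mult_pos_pos[OF s(2)[OF that] \<tau>(2)[OF that]] by (simp add: \<sigma>_def mult_ac)
    moreover have "(D (r t) * v t)\<^sup>2 = 1"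
      using D[OF that] by (simp add: power_mult_distrib)
    ultimately show ?thesis using \<sigma>(1) by (auto simp: power2_eq_1_iff)
  qed
  have "((\<lambda>t. t - \<sigma> * \<Phi> (r t)) has_real_derivative 0) (at t within T)" if "t \<in> T" for t
  proof -
    have "((\<lambda>t. \<Phi> (r t)) has_real_derivative D (r t) * v t) (at t within T)"
      using DERIV_chain2[OF \<Phi>[OF that] r[OF that]] has_field_derivative_at_within by blast
    then have "((\<lambda>t. \<sigma> * \<Phi> (r t)) has_real_derivative \<sigma> * \<sigma>) (at t within T)"
      unfolding speed[OF that] by (rule DERIV_cmult)
    from DERIV_diff[OF DERIV_ident this] show ?thesis by (simp add: \<sigma>)
  qed
  from has_field_derivative_zero_constant[OF is_interval_convex[OF T] this]
  obtain t0 where "\<And>t. t \<in> T \<Longrightarrow> t - \<sigma> * \<Phi> (r t) = t0" by blast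
  with \<sigma>(1) show ?thesis by (intro exI[of _ t0] bexI[of _ \<sigma>]) (auto simp: algebra_simps)
qed

text \<open>The case \<open>\<Phi> = G \<circ> amplitude p q\<close> of \<open>time_law\<close>. With
  \<open>S = sin\<^sup>2 \<phi> = (p r\<^sup>2 + q) / (1 + r\<^sup>2)\<close> one has \<open>dS/dr = 2 (p - q) r / (1 + r\<^sup>2)\<^sup>2\<close> and
  \<open>dS = 2 sin \<phi> cos \<phi> d\<phi>\<close>. Squaring \<open>G' \<phi> \<cdot> \<phi>' r \<cdot> v = \<plusminus> 1\<close> and clearing denominators gives the last
  hypothesis, in which only squares of trigonometric functions survive.\<close>

lemma elliptic_time_law:
  assumes pq: "p \<noteq> q"
    and S: "\<And>t. t \<in> T \<Longrightarrow> 0 < p * (r t)\<^sup>2 + q" "\<And>t. t \<in> T \<Longrightarrow> p * (r t)\<^sup>2 + q < 1 + (r t)\<^sup>2"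
    and G: "\<And>\<phi>. 0 < \<phi> \<Longrightarrow> \<phi> < pi / 2 \<Longrightarrow> (G has_real_derivative g \<phi>) (at \<phi>)"
    and g: "\<And>\<phi>. 0 < \<phi> \<Longrightarrow> \<phi> < pi / 2 \<Longrightarrow> 0 < g \<phi>"
    and eq: "\<And>t. t \<in> T \<Longrightarrow> (g (amplitude p q (r t)))\<^sup>2 * (p - q)\<^sup>2 * (r t)\<^sup>2 * (v t)\<^sup>2
      = (p * (r t)\<^sup>2 + q) * (1 + (r t)\<^sup>2 - (p * (r t)\<^sup>2 + q)) * (1 + (r t)\<^sup>2)\<^sup>2"
  shows "\<exists>t0. \<exists>\<sigma>\<in>{1, -1}. \<forall>t\<in>T. t = t0 + \<sigma> * G (amplitude p q (r t))"
proof (rule time_law[where \<Phi> = "\<lambda>x. G (amplitude p q x)" and s = "sgn (p - q)"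
      and D = "\<lambda>x. g (amplitude p q x) * ((p - q) * x /
         ((1 + x\<^sup>2)\<^sup>2 * (sin (amplitude p q x) * cos (amplitude p q x))))"])
  fix t assume t: "t \<in> T"
  define x \<phi> where "x = r t" and "\<phi> = amplitude p q x"
  note a = amplitude_props[OF S[OF t], folded x_def, folded \<phi>_def]
  have x1: "1 + x\<^sup>2 > 0" by (smt (verit) zero_le_power2)
  have sc: "sin \<phi> > 0" "cos \<phi> > 0" using a(1,2) by (auto intro: sin_gt_zero cos_gt_zero_pi)
  show "((\<lambda>x. G (amplitude p q x)) has_real_derivative
     g (amplitude p q (r t)) * ((p - q) * r t /
         ((1 + (r t)\<^sup>2)\<^sup>2 * (sin (amplitude p q (r t)) * cos (amplitude p q (r t)))))) (at (r t))"
    by (rule DERIV_chain2[OF G DERIV_amplitude]) (use a S[OF t] in \<open>auto simp: x_def \<phi>_def\<close>)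
  have "0 < \<bar>p - q\<bar> * (g \<phi> * x / ((1 + x\<^sup>2)\<^sup>2 * (sin \<phi> * cos \<phi>)))"
    using pq g[OF a(1,2)] pos[OF t] x1 sc by (auto simp: x_def intro!: mult_pos_pos divide_pos_pos)
  then show "0 < sgn (p - q) * (g (amplitude p q (r t)) * ((p - q) * r t /
         ((1 + (r t)\<^sup>2)\<^sup>2 * (sin (amplitude p q (r t)) * cos (amplitude p q (r t))))))"
    by (simp add: x_def \<phi>_def abs_sgn mult_ac)
  define N where "N = p * x\<^sup>2 + q"
  have N: "0 < N" "N < 1 + x\<^sup>2" using S[OF t] by (auto simp: N_def x_def)
  have "(g \<phi> * ((p - q) * x / ((1 + x\<^sup>2)\<^sup>2 * (sin \<phi> * cos \<phi>))))\<^sup>2 * (v t)\<^sup>2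
      = ((g \<phi>)\<^sup>2 * (p - q)\<^sup>2 * x\<^sup>2 * (v t)\<^sup>2) / ((1 + x\<^sup>2)^4 * ((sin \<phi>)\<^sup>2 * (cos \<phi>)\<^sup>2))"
    by (simp add: power_mult_distrib power_divide flip: power_mult)
  also have "(g \<phi>)\<^sup>2 * (p - q)\<^sup>2 * x\<^sup>2 * (v t)\<^sup>2 = N * (1 + x\<^sup>2 - N) * (1 + x\<^sup>2)\<^sup>2"
    using eq[OF t] by (simp add: x_def \<phi>_def N_def)
  also have "(1 + x\<^sup>2)^4 * ((sin \<phi>)\<^sup>2 * (cos \<phi>)\<^sup>2) = N * (1 + x\<^sup>2 - N) * (1 + x\<^sup>2)\<^sup>2"
  proof -
    have "w ^ 4 * (N / w * (1 - N / w)) = N * (w - N) * w\<^sup>2" if "w > 0" for w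
      using that by (simp add: field_simps power2_eq_square power4_eq_xxxx)
    then show ?thesis unfolding a(3,4) N_def[symmetric] using x1 by blast
  qed
  also have "\<dots> / \<dots> = 1" using N x1 by simp
  finally show "(g (amplitude p q (r t)) * ((p - q) * r t /
         ((1 + (r t)\<^sup>2)\<^sup>2 * (sin (amplitude p q (r t)) * cos (amplitude p q (r t))))))\<^sup>2 * (v t)\<^sup>2 = 1"
    by (simp add: x_def \<phi>_def)
qed (use pq in \<open>auto simp: sgn_if\<close>)

section \<open>The radial motion for each type of quartic\<close>

text \<open>With \<open>P = cosh s\<close> and \<open>Q = sinh s\<close> for the two square roots, the function in the formula is
  \<open>(P Q + s) / 2\<close>, a primitive of \<open>cosh\<^sup>2 s\<close>, up to a constant factor. That \<open>B\<close> is positive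
  follows from \<open>f > 0\<close> along the motion and \<open>C \<le> 0\<close>.\<close>

lemma time_law_degenerate:
  assumes "A = 0" "C \<le> 0"
  defines "a \<equiv> - C / B"
  shows "\<exists>t0. \<exists>\<sigma>\<in>{1, - 1}. \<forall>t\<in>T.
    t = t0 + \<sigma> * ((1 + a) / sqrt B *
      (1 / 2 * sqrt ((1 + (r t)\<^sup>2) / (1 + a)) * sqrt (((r t)\<^sup>2 - a) / (1 + a))
       + 1 / 2 * ln (sqrt ((1 + (r t)\<^sup>2) / (1 + a)) + sqrt (((r t)\<^sup>2 - a) / (1 + a)))))"
proof (cases "T = {}")
  case True
  then show ?thesis by (metis empty_iff insertCI)
next
  case False
  then obtain t1 where t1: "t1 \<in> T" by blast
  have "0 < B * (r t1)\<^sup>2" using quartic_pos[OF t1] assms by simp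
  then have B: "0 < B" by (simp add: zero_less_mult_iff)
  have "0 \<le> - C / B" using B assms(2) by (intro divide_nonneg_pos) auto
  then have a: "a \<ge> 0" "C = - a * B" using B by (auto simp: a_def)
  have gt: "a < (r t)\<^sup>2" if "t \<in> T" for t
  proof -
    have "0 < B * ((r t)\<^sup>2 - a)" using quartic_pos[OF that] assms(1) a by (simp add: algebra_simps)
    then show ?thesis using B by (simp add: zero_less_mult_iff)
  qed
  show ?thesis
  proof (rule time_law[where s = 1 and
        \<Phi> = "\<lambda>x. (1 + a) / sqrt B * (1 / 2 * sqrt ((1 + x\<^sup>2) / (1 + a)) * sqrt ((x\<^sup>2 - a) / (1 + a))
          + 1 / 2 * ln (sqrt ((1 + x\<^sup>2) / (1 + a)) + sqrt ((x\<^sup>2 - a) / (1 + a))))" and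
        D = "\<lambda>x. x / sqrt B * (sqrt ((1 + x\<^sup>2) / (1 + a)) / sqrt ((x\<^sup>2 - a) / (1 + a)))"])
    fix t assume t: "t \<in> T"
    define x where "x = r t"
    define P where "P = sqrt ((1 + x\<^sup>2) / (1 + a))"
    define Q where "Q = sqrt ((x\<^sup>2 - a) / (1 + a))"
    have x: "x > 0" "a < x\<^sup>2" using pos[OF t] gt[OF t] by (auto simp: x_def)
    have PQ: "P > 0" "Q > 0" "P\<^sup>2 = (1 + x\<^sup>2) / (1 + a)" "Q\<^sup>2 = (x\<^sup>2 - a) / (1 + a)"
      using x a by (auto simp: P_def Q_def)
    have dP: "((\<lambda>x. sqrt ((1 + x\<^sup>2) / (1 + a))) has_real_derivative x / (1 + a) / P) (at x)"
      unfolding P_def using x a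
      by (intro DERIV_sqrt_of) (auto intro!: derivative_eq_intros simp: add_pos_nonneg)
    have dQ: "((\<lambda>x. sqrt ((x\<^sup>2 - a) / (1 + a))) has_real_derivative x / (1 + a) / Q) (at x)"
      unfolding Q_def using x a by (intro DERIV_sqrt_of) (auto intro!: derivative_eq_intros)
    have rel: "P\<^sup>2 = Q\<^sup>2 + 1" using a(1) unfolding PQ(3,4) by (simp add: field_simps)
    have "((\<lambda>x. (1 + a) / sqrt B * (1 / 2 * sqrt ((1 + x\<^sup>2) / (1 + a)) * sqrt ((x\<^sup>2 - a) / (1 + a))
          + 1 / 2 * ln (sqrt ((1 + x\<^sup>2) / (1 + a)) + sqrt ((x\<^sup>2 - a) / (1 + a))))) has_real_derivative
        (1 + a) / sqrt B * ((1 / 2 * (x / (1 + a) / P)) * Q + (x / (1 + a) / Q) * (1 / 2 * P)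
          + 1 / 2 * (1 / (P + Q) * (x / (1 + a) / P + x / (1 + a) / Q)))) (at x)"
      unfolding P_def Q_def
      by (intro DERIV_cmult DERIV_add DERIV_mult dP[unfolded P_def] dQ[unfolded Q_def]
            DERIV_chain2[where f = ln] DERIV_ln_divide)
         (use add_pos_pos[OF PQ(1,2)] in \<open>simp only: P_def Q_def\<close>)
    also have "(1 + a) / sqrt B * ((1 / 2 * (x / (1 + a) / P)) * Q + (x / (1 + a) / Q) * (1 / 2 * P)
          + 1 / 2 * (1 / (P + Q) * (x / (1 + a) / P + x / (1 + a) / Q))) = x / sqrt B * (P / Q)"
    proof -
      have 1: "1 / (P + Q) * (1 / P + 1 / Q) = 1 / (P * Q)"
        using PQ(1,2) by (simp add: divide_simps)
      have 2: "Q / P + P / Q + 1 / (P * Q) = 2 * (P / Q)"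
        using PQ(1,2) rel by (simp add: divide_simps power2_eq_square)
      have "(1 + a) / sqrt B * ((1 / 2 * (x / (1 + a) / P)) * Q + (x / (1 + a) / Q) * (1 / 2 * P)
          + 1 / 2 * (1 / (P + Q) * (x / (1 + a) / P + x / (1 + a) / Q)))
        = (1 + a) / sqrt B * (x / (1 + a) * (1 / 2 * (Q / P + P / Q + 1 / (P + Q) * (1 / P + 1 / Q))))"
        by (simp add: algebra_simps)
      also have "\<dots> = x / sqrt B * (P / Q)"
        unfolding 1 2 using a(1) by simp
      finally show ?thesis .
    qed
    finally show "((\<lambda>x. (1 + a) / sqrt B * (1 / 2 * sqrt ((1 + x\<^sup>2) / (1 + a)) * sqrt ((x\<^sup>2 - a) / (1 + a))
          + 1 / 2 * ln (sqrt ((1 + x\<^sup>2) / (1 + a)) + sqrt ((x\<^sup>2 - a) / (1 + a))))) has_real_derivative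
        r t / sqrt B * (sqrt ((1 + (r t)\<^sup>2) / (1 + a)) / sqrt (((r t)\<^sup>2 - a) / (1 + a)))) (at (r t))"
      by (simp only: x_def P_def Q_def)
    have "0 < x / sqrt B * (P / Q)" using x B PQ by simp
    then show "0 < 1 * (r t / sqrt B * (sqrt ((1 + (r t)\<^sup>2) / (1 + a)) / sqrt (((r t)\<^sup>2 - a) / (1 + a))))"
      by (simp add: x_def P_def Q_def)
    have "x\<^sup>2 * (1 + x\<^sup>2) * (v t)\<^sup>2 = B * (x\<^sup>2 - a)"
      using energy[OF t] assms(1) a by (simp add: quartic_def x_def algebra_simps)
    moreover have "(x / sqrt B * (P / Q))\<^sup>2 * (v t)\<^sup>2 = x\<^sup>2 * (1 + x\<^sup>2) * (v t)\<^sup>2 / (B * (x\<^sup>2 - a))"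
      using B a x by (simp add: power_mult_distrib power_divide PQ(3,4))
    ultimately have "(x / sqrt B * (P / Q))\<^sup>2 * (v t)\<^sup>2 = 1" using B x by simp
    then show "(r t / sqrt B * (sqrt ((1 + (r t)\<^sup>2) / (1 + a)) / sqrt (((r t)\<^sup>2 - a) / (1 + a))))\<^sup>2 * (v t)\<^sup>2 = 1"
      by (simp only: x_def P_def Q_def)
  qed (rule insertI1)
qed

text \<open>The factor \<open>1 + r\<^sup>2\<close> of \<open>f\<close> cancels against the one in the radial equation, which leaves
  \<open>r r' = \<plusminus> sqrt (A (r\<^sup>2 - \<alpha>\<^sup>2))\<close> and an elementary integral.\<close>

lemma time_law_unit_imaginary_roots:
  assumes A: "0 < A" and BC: "B = A * (1 - \<alpha>\<^sup>2)" "C = - (A * \<alpha>\<^sup>2)"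
  shows "\<exists>t0. \<exists>\<sigma>\<in>{1, - 1}. \<forall>t\<in>T. t = t0 + \<sigma> * sqrt (((r t)\<^sup>2 - \<alpha>\<^sup>2) / A)"
proof (rule time_law[where s = 1 and \<Phi> = "\<lambda>x. sqrt ((x\<^sup>2 - \<alpha>\<^sup>2) / A)" and
      D = "\<lambda>x. x / A / sqrt ((x\<^sup>2 - \<alpha>\<^sup>2) / A)"])
  fix t assume t: "t \<in> T"
  define x where "x = r t"
  have x1: "1 + x\<^sup>2 > 0" by (smt (verit) zero_le_power2)
  have f: "A * x ^ 4 + B * x\<^sup>2 + C = A * (x\<^sup>2 - \<alpha>\<^sup>2) * (1 + x\<^sup>2)"
    by (simp add: BC) algebra
  then have "0 < A * (x\<^sup>2 - \<alpha>\<^sup>2) * (1 + x\<^sup>2)" using quartic_pos[OF t] by (simp add: x_def)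
  then have x: "x > 0" "\<alpha>\<^sup>2 < x\<^sup>2" using pos[OF t] A x1 by (auto simp: zero_less_mult_iff x_def)
  show "((\<lambda>x. sqrt ((x\<^sup>2 - \<alpha>\<^sup>2) / A)) has_real_derivative r t / A / sqrt (((r t)\<^sup>2 - \<alpha>\<^sup>2) / A)) (at (r t))"
    unfolding x_def[symmetric] using x A
    by (intro DERIV_sqrt_of) (auto intro!: derivative_eq_intros)
  show "0 < 1 * (r t / A / sqrt (((r t)\<^sup>2 - \<alpha>\<^sup>2) / A))"
    unfolding x_def[symmetric] using x A by simp
  have "(1 + x\<^sup>2) * (x\<^sup>2 * (v t)\<^sup>2) = (1 + x\<^sup>2) * (A * (x\<^sup>2 - \<alpha>\<^sup>2))"
    using energy[OF t] f by (simp add: quartic_def x_def mult_ac)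
  then have "x\<^sup>2 * (v t)\<^sup>2 = A * (x\<^sup>2 - \<alpha>\<^sup>2)" using x1 by simp
  moreover have "(sqrt ((x\<^sup>2 - \<alpha>\<^sup>2) / A))\<^sup>2 = (x\<^sup>2 - \<alpha>\<^sup>2) / A" using x A by simp
  then have "(x / A / sqrt ((x\<^sup>2 - \<alpha>\<^sup>2) / A))\<^sup>2 * (v t)\<^sup>2 = x\<^sup>2 * (v t)\<^sup>2 / (A * (x\<^sup>2 - \<alpha>\<^sup>2))"
    unfolding power_divide using A by (simp add: power2_eq_square[of A])
  ultimately show "(r t / A / sqrt (((r t)\<^sup>2 - \<alpha>\<^sup>2) / A))\<^sup>2 * (v t)\<^sup>2 = 1"
    unfolding x_def[symmetric] using x A by simp
qed simp

text \<open>Here \<open>r = tan \<phi>\<close>, that is \<open>p = 1\<close> and \<open>q = 0\<close>, and the radial equation is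
  \<open>(1 + r\<^sup>2) r'\<^sup>2 = 1 + A r\<^sup>2\<close>. Since \<open>A = 1 - k\<^sup>2\<close>, the sum \<open>F + (dn sc - E) / A\<close> is the primitive of
  \<open>nc\<^sup>2\<close>.\<close>

lemma time_law_double_root_zero:
  assumes A: "0 < A" "A < 1" and BC: "B = 1" "C = 0"
  defines "k \<equiv> sqrt (1 - A)"
  shows "\<exists>t0. \<exists>\<sigma>\<in>{1, - 1}. \<forall>t\<in>T. \<exists>u \<phi>.
    is_the_solution (\<lambda>v. sc v k) (r t) k u \<and> \<phi> = am u k \<and>
    t = t0 + \<sigma> * ellF \<phi> k + \<sigma> * (1 / A * (dn u k * sc u k - jacobi_E u k))"
proof -
  have k: "0 \<le> k" "k < 1" "k\<^sup>2 = 1 - A" using A by (auto simp: k_def)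
  define G where "G = (\<lambda>\<phi>. 1 / A * ((1 - k\<^sup>2) * ellF \<phi> k - ellE \<phi> k
    + sqrt (1 - k\<^sup>2 * (sin \<phi>)\<^sup>2) * (sin \<phi> / cos \<phi>)))"
  define \<phi> where "\<phi> t = amplitude 1 0 (r t)" for t
  have bounds: "0 < 1 * (r t)\<^sup>2 + 0" "1 * (r t)\<^sup>2 + 0 < 1 + (r t)\<^sup>2" if "t \<in> T" for t
    using pos[OF that] by auto
  have "\<exists>t0. \<exists>\<sigma>\<in>{1, - 1}. \<forall>t\<in>T. t = t0 + \<sigma> * G (amplitude 1 0 (r t))"
  proof (rule elliptic_time_law[where g = "\<lambda>\<phi>. 1 / A * ((1 - k\<^sup>2) / ((cos \<phi>)\<^sup>2 * sqrt (1 - k\<^sup>2 * (sin \<phi>)\<^sup>2)))", OF _ bounds])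
    fix x :: real assume x: "0 < x" "x < pi / 2"
    show "(G has_real_derivative 1 / A * ((1 - k\<^sup>2) / ((cos x)\<^sup>2 * sqrt (1 - k\<^sup>2 * (sin x)\<^sup>2)))) (at x)"
      unfolding G_def by (intro DERIV_cmult DERIV_nc_squared_primitive k x)
    show "0 < 1 / A * ((1 - k\<^sup>2) / ((cos x)\<^sup>2 * sqrt (1 - k\<^sup>2 * (sin x)\<^sup>2)))"
      using A k(3) Delta_pos[OF k(1,2)] cos_gt_zero_pi[of x] x by simp
  next
    fix t assume t: "t \<in> T"
    define x w V where "x = r t" and "w = 1 + x\<^sup>2" and "V = (v t)\<^sup>2"
    note amp = amplitude_props[OF bounds[OF t], folded x_def, folded w_def]
    have x: "x > 0" "w > 0" using pos[OF t] by (auto simp: x_def w_def add_pos_nonneg)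
    have c: "(cos (amplitude 1 0 x))\<^sup>2 = 1 / w" using x unfolding amp by (simp add: w_def field_simps)
    have d: "1 - k\<^sup>2 * (sin (amplitude 1 0 x))\<^sup>2 = (1 + A * x\<^sup>2) / w"
    proof -
      have "x\<^sup>2 = w - 1" by (simp add: w_def)
      then show ?thesis using x unfolding amp k by (simp add: field_simps)
    qed
    have Ax: "1 + A * x\<^sup>2 > 0" using A by (simp add: add_pos_nonneg)
    have "x\<^sup>2 * (w * V) = x\<^sup>2 * (1 + A * x\<^sup>2)"
      using energy[OF t] BC by (simp add: quartic_def x_def w_def V_def power2_eq_square power4_eq_xxxx algebra_simps)
    then have V: "w * V = 1 + A * x\<^sup>2" using x by simp
    have "(1 / A * ((1 - k\<^sup>2) / ((cos (amplitude 1 0 x))\<^sup>2 * sqrt (1 - k\<^sup>2 * (sin (amplitude 1 0 x))\<^sup>2))))\<^sup>2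
       = w\<^sup>2 * w / (1 + A * x\<^sup>2)"
      unfolding d c using A x Ax by (simp add: k power_mult_distrib power_divide)
    then have "(1 / A * ((1 - k\<^sup>2) / ((cos (amplitude 1 0 x))\<^sup>2 * sqrt (1 - k\<^sup>2 * (sin (amplitude 1 0 x))\<^sup>2))))\<^sup>2
       * (1 - 0)\<^sup>2 * x\<^sup>2 * V = w\<^sup>2 * x\<^sup>2 * (w * V) / (1 + A * x\<^sup>2)" by simp
    also have "\<dots> = (1 * x\<^sup>2 + 0) * (w - (1 * x\<^sup>2 + 0)) * w\<^sup>2"
      unfolding V using Ax by (simp add: w_def)
    finally show "(1 / A * ((1 - k\<^sup>2) / ((cos (amplitude 1 0 (r t)))\<^sup>2 * sqrt (1 - k\<^sup>2 * (sin (amplitude 1 0 (r t)))\<^sup>2))))\<^sup>2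
       * (1 - 0)\<^sup>2 * (r t)\<^sup>2 * (v t)\<^sup>2
       = (1 * (r t)\<^sup>2 + 0) * (1 + (r t)\<^sup>2 - (1 * (r t)\<^sup>2 + 0)) * (1 + (r t)\<^sup>2)\<^sup>2"
      unfolding x_def w_def V_def .
  qed auto
  then obtain t0 \<sigma> where \<sigma>: "\<sigma> \<in> {1, -1}" and time: "\<And>t. t \<in> T \<Longrightarrow> t = t0 + \<sigma> * G (\<phi> t)"
    unfolding \<phi>_def by blast
  have "\<exists>u \<phi>. is_the_solution (\<lambda>v. sc v k) (r t) k u \<and> \<phi> = am u k \<and>
      t = t0 + \<sigma> * ellF \<phi> k + \<sigma> * (1 / A * (dn u k * sc u k - jacobi_E u k))" if t: "t \<in> T" for t
  proof (intro exI conjI)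
    note amp = amplitude_props[OF bounds[OF t], folded \<phi>_def]
    show "is_the_solution (\<lambda>v. sc v k) (r t) k (ellF (\<phi> t) k)"
    proof (rule is_the_solution_ellF[OF k(1,2) amp(1,2)])
      fix \<psi> :: real assume \<psi>: "0 < \<psi>" "\<psi> < pi / 2"
      then have p: "sin \<psi> > 0" "cos \<psi> > 0" by (auto intro: sin_gt_zero cos_gt_zero_pi)
      have x1: "1 + (r t)\<^sup>2 > 0" by (simp add: add_pos_nonneg)
      have "sc (ellF \<psi> k) k = r t \<longleftrightarrow> sin \<psi> = r t * cos \<psi>"
        using p by (simp add: sc_def jacobi_at_ellF[OF k(1,2)] field_simps)
      also have "\<dots> \<longleftrightarrow> (sin \<psi>)\<^sup>2 = (r t * cos \<psi>)\<^sup>2"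
        using p pos[OF t] by (simp add: power2_eq_iff_nonneg)
      also have "\<dots> \<longleftrightarrow> (sin \<psi>)\<^sup>2 = (sin (\<phi> t))\<^sup>2"
        unfolding amp(3) using x1 by (simp add: power_mult_distrib cos_squared_eq field_simps)
      finally show "sc (ellF \<psi> k) k = r t \<longleftrightarrow> (sin \<psi>)\<^sup>2 = (sin (\<phi> t))\<^sup>2" .
    qed
    show "\<phi> t = am (ellF (\<phi> t) k) k" by (simp add: am_ellF k)
    have "G (\<phi> t) = ellF (\<phi> t) k + 1 / A * (dn (ellF (\<phi> t) k) k * sc (ellF (\<phi> t) k) k - jacobi_E (ellF (\<phi> t) k) k)"
      using A by (simp add: G_def sc_def jacobi_at_ellF[OF k(1,2)] k(3) field_simps)
    with time[OF t] show "t = t0 + \<sigma> * ellF (\<phi> t) k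
        + \<sigma> * (1 / A * (dn (ellF (\<phi> t) k) k * sc (ellF (\<phi> t) k) k - jacobi_E (ellF (\<phi> t) k) k))"
      by (simp add: ring_distribs)
  qed
  with \<sigma> show ?thesis by blast
qed

text \<open>Here \<open>sin\<^sup>2 \<phi> = (\<alpha>\<^sup>2 + 1) / (r\<^sup>2 + 1)\<close>, that is \<open>p = 0\<close> and \<open>q = n = \<alpha>\<^sup>2 + 1\<close>. The modulus is the one
  for which \<open>dn\<^sup>2 = (r\<^sup>2 + \<beta>\<^sup>2) / (r\<^sup>2 + 1)\<close>, and \<open>dt\<close> becomes a constant multiple of \<open>ns\<^sup>2 u du\<close>.\<close>

lemma time_law_small_imaginary_roots:
  assumes A: "0 < A" and \<beta>: "\<beta>\<^sup>2 < 1"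
    and BC: "B = A * (\<beta>\<^sup>2 - \<alpha>\<^sup>2)" "C = - (A * \<alpha>\<^sup>2 * \<beta>\<^sup>2)"
    and k: "0 \<le> k" "k < 1" "k\<^sup>2 = (1 - \<beta>\<^sup>2) / (\<alpha>\<^sup>2 + 1)"
  shows "\<exists>t0. \<exists>\<sigma>\<in>{1, - 1}. \<forall>t\<in>T. \<exists>u.
    is_the_solution (\<lambda>v. ns v k) (sqrt (((r t)\<^sup>2 + 1) / (\<alpha>\<^sup>2 + 1))) k u \<and>
    t = t0 + \<sigma> * (sqrt (\<alpha>\<^sup>2 + 1) / sqrt A * (u - jacobi_E u k - dn u k * cs u k))"
proof -
  define n where "n = \<alpha>\<^sup>2 + 1"
  have n: "n > 0" by (simp add: n_def add_nonneg_pos)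
  define c where "c = sqrt n / sqrt A"
  have c: "c > 0" "c\<^sup>2 = n / A" using A n by (auto simp: c_def power_divide)
  define \<phi> where "\<phi> t = amplitude 0 n (r t)" for t
  define G where "G = (\<lambda>\<phi>. c * (ellF \<phi> k - ellE \<phi> k - sqrt (1 - k\<^sup>2 * (sin \<phi>)\<^sup>2) * (cos \<phi> / sin \<phi>)))"
  define g where "g = (\<lambda>\<phi>. c * (1 / ((sin \<phi>)\<^sup>2 * sqrt (1 - k\<^sup>2 * (sin \<phi>)\<^sup>2))))"
  have f: "A * x ^ 4 + B * x\<^sup>2 + C = A * (x\<^sup>2 - \<alpha>\<^sup>2) * (x\<^sup>2 + \<beta>\<^sup>2)" for x
    by (simp add: BC) algebra
  have xb: "0 < (r t)\<^sup>2 + \<beta>\<^sup>2" if "t \<in> T" for t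
    using pos[OF that] by (simp add: add_pos_nonneg)
  have gt: "\<alpha>\<^sup>2 < (r t)\<^sup>2" if "t \<in> T" for t
    using quartic_pos[OF that] xb[OF that] A unfolding f by (simp add: zero_less_mult_iff)
  have bounds: "0 < 0 * (r t)\<^sup>2 + n" "0 * (r t)\<^sup>2 + n < 1 + (r t)\<^sup>2" if "t \<in> T" for t
    using n gt[OF that] by (auto simp: n_def)
  have "\<exists>t0. \<exists>\<sigma>\<in>{1, - 1}. \<forall>t\<in>T. t = t0 + \<sigma> * G (amplitude 0 n (r t))"
  proof (rule elliptic_time_law[where g = g, OF _ bounds])
    fix x :: real assume x: "0 < x" "x < pi / 2"
    show "(G has_real_derivative g x) (at x)"
      unfolding G_def g_def by (intro DERIV_cmult DERIV_ns_squared_primitive k x)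
    show "0 < g x"
      unfolding g_def using c Delta_pos[OF k(1,2)] sin_gt_zero[of x] x by simp
  next
    fix t assume t: "t \<in> T"
    define x w V where "x = r t" and "w = 1 + x\<^sup>2" and "V = (v t)\<^sup>2"
    note amp = amplitude_props[OF bounds[OF t], folded x_def, folded w_def]
    have w: "w > 0" by (simp add: w_def add_pos_nonneg)
    define y where "y = x\<^sup>2 + \<beta>\<^sup>2"
    have y: "0 < y" using xb[OF t] by (simp add: x_def y_def)
    have s: "(sin (amplitude 0 n x))\<^sup>2 = n / w" unfolding amp by simp
    have d: "1 - k\<^sup>2 * (n / w) = y / w"
    proof -
      have "k\<^sup>2 * n = 1 - \<beta>\<^sup>2" using n by (simp add: k(3) n_def[symmetric])
      then have "1 - k\<^sup>2 * (n / w) = (w - (1 - \<beta>\<^sup>2)) / w" using w by (simp add: field_simps)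
      then show ?thesis by (simp add: w_def y_def)
    qed
    have V: "x\<^sup>2 * w * V = A * (x\<^sup>2 - \<alpha>\<^sup>2) * y"
      using energy[OF t] f[of x] by (simp add: quartic_def x_def w_def V_def y_def)
    have "(g (amplitude 0 n x))\<^sup>2 = n / A * (w\<^sup>2 / n\<^sup>2 * (w / y))"
      unfolding g_def s d using y w by (simp add: power_mult_distrib power_divide c)
    then have "(g (amplitude 0 n x))\<^sup>2 * (0 - n)\<^sup>2 * x\<^sup>2 * V
       = n / (A * y) * w\<^sup>2 * (x\<^sup>2 * w * V)" using n by simp
    also have "\<dots> = (0 * x\<^sup>2 + n) * (w - (0 * x\<^sup>2 + n)) * w\<^sup>2"
    proof -
      have "w - n = x\<^sup>2 - \<alpha>\<^sup>2" by (simp add: w_def n_def)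
      then have rhs: "(0 * x\<^sup>2 + n) * (w - (0 * x\<^sup>2 + n)) * w\<^sup>2 = n * (x\<^sup>2 - \<alpha>\<^sup>2) * w\<^sup>2"
        by simp
      show ?thesis unfolding V rhs using y A by simp
    qed
    finally show "(g (amplitude 0 n (r t)))\<^sup>2 * (0 - n)\<^sup>2 * (r t)\<^sup>2 * (v t)\<^sup>2
       = (0 * (r t)\<^sup>2 + n) * (1 + (r t)\<^sup>2 - (0 * (r t)\<^sup>2 + n)) * (1 + (r t)\<^sup>2)\<^sup>2"
      unfolding x_def w_def V_def .
  qed (use n in auto)
  then obtain t0 \<sigma> where \<sigma>: "\<sigma> \<in> {1, -1}" and time: "\<And>t. t \<in> T \<Longrightarrow> t = t0 + \<sigma> * G (\<phi> t)"
    unfolding \<phi>_def by blast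
  have "\<exists>u. is_the_solution (\<lambda>v. ns v k) (sqrt (((r t)\<^sup>2 + 1) / n)) k u \<and>
      t = t0 + \<sigma> * (c * (u - jacobi_E u k - dn u k * cs u k))" if t: "t \<in> T" for t
  proof (intro exI conjI)
    note amp = amplitude_props[OF bounds[OF t], folded \<phi>_def]
    show "is_the_solution (\<lambda>v. ns v k) (sqrt (((r t)\<^sup>2 + 1) / n)) k (ellF (\<phi> t) k)"
    proof (rule is_the_solution_ellF[OF k(1,2) amp(1,2)])
      fix \<psi> :: real assume \<psi>: "0 < \<psi>" "\<psi> < pi / 2"
      then have p: "sin \<psi> > 0" by (auto intro: sin_gt_zero)
      show "ns (ellF \<psi> k) k = sqrt (((r t)\<^sup>2 + 1) / n) \<longleftrightarrow> (sin \<psi>)\<^sup>2 = (sin (\<phi> t))\<^sup>2"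
        unfolding ns_def jacobi_at_ellF[OF k(1,2)] inverse_eq_sqrt_iff[OF p] amp(3)
        by (simp add: add.commute)
    qed
    show "t = t0 + \<sigma> * (c * (ellF (\<phi> t) k - jacobi_E (ellF (\<phi> t) k) k
        - dn (ellF (\<phi> t) k) k * cs (ellF (\<phi> t) k) k))"
      using time[OF t] by (simp add: G_def cs_def jacobi_at_ellF[OF k(1,2)])
  qed
  with \<sigma> show ?thesis unfolding c_def n_def by blast
qed

text \<open>Here \<open>cos\<^sup>2 \<phi> = (\<alpha>\<^sup>2 + 1) / (r\<^sup>2 + 1)\<close>, that is \<open>p = 1\<close> and \<open>q = - \<alpha>\<^sup>2\<close>. The modulus makes \<open>dn\<^sup>2\<close>
  a constant multiple of \<open>(r\<^sup>2 + \<beta>\<^sup>2) / (r\<^sup>2 + 1)\<close>, and \<open>dt\<close> becomes a constant multiple of \<open>nc\<^sup>2 u du\<close>.\<close>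

lemma time_law_large_imaginary_roots:
  assumes A: "0 < A" and \<beta>: "1 < \<beta>\<^sup>2"
    and BC: "B = A * (\<beta>\<^sup>2 - \<alpha>\<^sup>2)" "C = - (A * \<alpha>\<^sup>2 * \<beta>\<^sup>2)"
    and k: "0 \<le> k" "k < 1" "1 - k\<^sup>2 = (\<alpha>\<^sup>2 + 1) / (\<alpha>\<^sup>2 + \<beta>\<^sup>2)"
  shows "\<exists>t0. \<exists>\<sigma>\<in>{1, - 1}. \<forall>t\<in>T. \<exists>u.
    is_the_solution (\<lambda>v. nc v k) (sqrt (((r t)\<^sup>2 + 1) / (\<alpha>\<^sup>2 + 1))) k u \<and>
    t = t0 + \<sigma> * ((\<alpha>\<^sup>2 + 1) / ((1 - k\<^sup>2) * sqrt (A * (\<alpha>\<^sup>2 + \<beta>\<^sup>2))) *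
      ((1 - k\<^sup>2) * u - jacobi_E u k + dn u k * sc u k))"
proof -
  define n where "n = \<alpha>\<^sup>2 + 1"
  define m where "m = \<alpha>\<^sup>2 + \<beta>\<^sup>2"
  have n: "n > 0" by (simp add: n_def add_nonneg_pos)
  have m: "m > 0" using \<beta> zero_le_power2[of \<alpha>] unfolding m_def by linarith
  have k': "1 - k\<^sup>2 = n / m" by (simp add: k(3) n_def m_def)
  then have k'_pos: "1 - k\<^sup>2 > 0" using n m by simp
  define c where "c = n / ((1 - k\<^sup>2) * sqrt (A * m))"
  have c: "c > 0" "(c * (1 - k\<^sup>2))\<^sup>2 = n\<^sup>2 / (A * m)"
    using A n m k'_pos by (auto simp: c_def power_divide)
  define \<phi> where "\<phi> t = amplitude 1 (- \<alpha>\<^sup>2) (r t)" for t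
  define G where "G = (\<lambda>\<phi>. c * ((1 - k\<^sup>2) * ellF \<phi> k - ellE \<phi> k
    + sqrt (1 - k\<^sup>2 * (sin \<phi>)\<^sup>2) * (sin \<phi> / cos \<phi>)))"
  define g where "g = (\<lambda>\<phi>. c * ((1 - k\<^sup>2) / ((cos \<phi>)\<^sup>2 * sqrt (1 - k\<^sup>2 * (sin \<phi>)\<^sup>2))))"
  have f: "A * x ^ 4 + B * x\<^sup>2 + C = A * (x\<^sup>2 - \<alpha>\<^sup>2) * (x\<^sup>2 + \<beta>\<^sup>2)" for x
    by (simp add: BC) algebra
  have xb: "0 < (r t)\<^sup>2 + \<beta>\<^sup>2" if "t \<in> T" for t
    using pos[OF that] by (simp add: add_pos_nonneg)
  have gt: "\<alpha>\<^sup>2 < (r t)\<^sup>2" if "t \<in> T" for t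
    using quartic_pos[OF that] xb[OF that] A unfolding f by (simp add: zero_less_mult_iff)
  have bounds: "0 < 1 * (r t)\<^sup>2 + - \<alpha>\<^sup>2" "1 * (r t)\<^sup>2 + - \<alpha>\<^sup>2 < 1 + (r t)\<^sup>2" if "t \<in> T" for t
    using gt[OF that] zero_le_power2[of \<alpha>] by linarith+
  have cos: "(cos (amplitude 1 (- \<alpha>\<^sup>2) (r t)))\<^sup>2 = n / (1 + (r t)\<^sup>2)" if "t \<in> T" for t
  proof -
    have "1 + (r t)\<^sup>2 > 0" by (simp add: add_pos_nonneg)
    then show ?thesis unfolding amplitude_props[OF bounds[OF that]] by (simp add: n_def field_simps)
  qed
  have "\<exists>t0. \<exists>\<sigma>\<in>{1, - 1}. \<forall>t\<in>T. t = t0 + \<sigma> * G (amplitude 1 (- \<alpha>\<^sup>2) (r t))"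
  proof (rule elliptic_time_law[where g = g, OF _ bounds])
    show "1 \<noteq> - \<alpha>\<^sup>2" using zero_le_power2[of \<alpha>] by linarith
  next
    fix x :: real assume x: "0 < x" "x < pi / 2"
    show "(G has_real_derivative g x) (at x)"
      unfolding G_def g_def by (intro DERIV_cmult DERIV_nc_squared_primitive k x)
    show "0 < g x"
      unfolding g_def using c k'_pos Delta_pos[OF k(1,2)] cos_gt_zero_pi[of x] x by simp
  next
    fix t assume t: "t \<in> T"
    define x w V where "x = r t" and "w = 1 + x\<^sup>2" and "V = (v t)\<^sup>2"
    have w: "w > 0" by (simp add: w_def add_pos_nonneg)
    define y where "y = x\<^sup>2 + \<beta>\<^sup>2"
    have y: "0 < y" using xb[OF t] by (simp add: x_def y_def)
    have c2: "(cos (amplitude 1 (- \<alpha>\<^sup>2) x))\<^sup>2 = n / w" using cos[OF t] by (simp add: x_def w_def)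
    have d: "1 - k\<^sup>2 * (sin (amplitude 1 (- \<alpha>\<^sup>2) x))\<^sup>2 = n * y / (m * w)"
    proof -
      have "1 - k\<^sup>2 * (sin (amplitude 1 (- \<alpha>\<^sup>2) x))\<^sup>2 = (1 - k\<^sup>2) + (1 - (1 - k\<^sup>2)) * (n / w)"
        unfolding c2[symmetric] by (simp add: sin_squared_eq algebra_simps)
      also have "\<dots> = n * (w + m - n) / (m * w)"
        unfolding k' using m w by (simp add: field_simps)
      also have "w + m - n = y" by (simp add: w_def m_def n_def y_def)
      finally show ?thesis .
    qed
    have V: "x\<^sup>2 * w * V = A * (x\<^sup>2 - \<alpha>\<^sup>2) * y"
      using energy[OF t] f[of x] by (simp add: quartic_def x_def w_def V_def y_def)
    have "(g (amplitude 1 (- \<alpha>\<^sup>2) x))\<^sup>2 = (c * (1 - k\<^sup>2))\<^sup>2 / ((n / w)\<^sup>2 * (n * y / (m * w)))"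
      unfolding g_def d c2 using y w n m by (simp add: power_mult_distrib power_divide)
    also have "\<dots> = w\<^sup>2 * w / (A * n * y)"
      unfolding c using n m by (simp add: power_divide)
    finally have "(g (amplitude 1 (- \<alpha>\<^sup>2) x))\<^sup>2 * (1 - - \<alpha>\<^sup>2)\<^sup>2 * x\<^sup>2 * V
       = n\<^sup>2 / (A * n * y) * w\<^sup>2 * (x\<^sup>2 * w * V)" by (simp add: n_def add.commute)
    also have "\<dots> = (1 * x\<^sup>2 + - \<alpha>\<^sup>2) * (w - (1 * x\<^sup>2 + - \<alpha>\<^sup>2)) * w\<^sup>2"
    proof -
      have "w - (1 * x\<^sup>2 + - \<alpha>\<^sup>2) = n" by (simp add: w_def n_def)
      then show ?thesis unfolding V using y A n by (simp add: power2_eq_square[of n])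
    qed
    finally show "(g (amplitude 1 (- \<alpha>\<^sup>2) (r t)))\<^sup>2 * (1 - - \<alpha>\<^sup>2)\<^sup>2 * (r t)\<^sup>2 * (v t)\<^sup>2
       = (1 * (r t)\<^sup>2 + - \<alpha>\<^sup>2) * (1 + (r t)\<^sup>2 - (1 * (r t)\<^sup>2 + - \<alpha>\<^sup>2)) * (1 + (r t)\<^sup>2)\<^sup>2"
      unfolding x_def w_def V_def .
  qed
  then obtain t0 \<sigma> where \<sigma>: "\<sigma> \<in> {1, -1}" and time: "\<And>t. t \<in> T \<Longrightarrow> t = t0 + \<sigma> * G (\<phi> t)"
    unfolding \<phi>_def by blast
  have "\<exists>u. is_the_solution (\<lambda>v. nc v k) (sqrt (((r t)\<^sup>2 + 1) / n)) k u \<and>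
      t = t0 + \<sigma> * (c * ((1 - k\<^sup>2) * u - jacobi_E u k + dn u k * sc u k))" if t: "t \<in> T" for t
  proof (intro exI conjI)
    note amp = amplitude_props[OF bounds[OF t], folded \<phi>_def]
    show "is_the_solution (\<lambda>v. nc v k) (sqrt (((r t)\<^sup>2 + 1) / n)) k (ellF (\<phi> t) k)"
    proof (rule is_the_solution_ellF[OF k(1,2) amp(1,2)])
      fix \<psi> :: real assume \<psi>: "0 < \<psi>" "\<psi> < pi / 2"
      then have p: "cos \<psi> > 0" by (auto intro: cos_gt_zero_pi)
      have "nc (ellF \<psi> k) k = sqrt (((r t)\<^sup>2 + 1) / n) \<longleftrightarrow> (cos \<psi>)\<^sup>2 = (cos (\<phi> t))\<^sup>2"
        unfolding nc_def jacobi_at_ellF[OF k(1,2)] inverse_eq_sqrt_iff[OF p] cos[OF t, folded \<phi>_def]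
        by (simp add: add.commute)
      then show "nc (ellF \<psi> k) k = sqrt (((r t)\<^sup>2 + 1) / n) \<longleftrightarrow> (sin \<psi>)\<^sup>2 = (sin (\<phi> t))\<^sup>2"
        by (simp add: cos_squared_eq)
    qed
    show "t = t0 + \<sigma> * (c * ((1 - k\<^sup>2) * ellF (\<phi> t) k - jacobi_E (ellF (\<phi> t) k) k
        + dn (ellF (\<phi> t) k) k * sc (ellF (\<phi> t) k) k))"
      using time[OF t] by (simp add: G_def sc_def jacobi_at_ellF[OF k(1,2)])
  qed
  with \<sigma> show ?thesis unfolding c_def n_def m_def by blast
qed

text \<open>As \<open>f > 0\<close> and \<open>A < 0\<close>, \<open>r\<^sup>2\<close> stays between \<open>\<alpha>\<^sup>2\<close> and \<open>\<beta>\<^sup>2\<close>. The equation for \<open>u\<close> is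
  \<open>dn\<^sup>2 = (\<alpha>\<^sup>2 + 1) / (r\<^sup>2 + 1)\<close>, and solving it for \<open>sn\<^sup>2\<close> gives the constants \<open>p\<close> and \<open>q\<close> of the proof.
  Then \<open>cn\<^sup>2\<close> is a constant multiple of \<open>(\<beta>\<^sup>2 - r\<^sup>2) / (r\<^sup>2 + 1)\<close>, and \<open>dt\<close> becomes a constant multiple
  of \<open>nd\<^sup>2 u du\<close>.\<close>

lemma time_law_four_real_roots:
  assumes A: "A < 0" and \<alpha>\<beta>: "\<alpha>\<^sup>2 < \<beta>\<^sup>2"
    and BC: "B = - (A * (\<alpha>\<^sup>2 + \<beta>\<^sup>2))" "C = A * \<alpha>\<^sup>2 * \<beta>\<^sup>2"
    and k: "0 \<le> k" "k < 1" "1 - k\<^sup>2 = (\<alpha>\<^sup>2 + 1) / (\<beta>\<^sup>2 + 1)"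
  shows "\<exists>t0. \<exists>\<sigma>\<in>{1, - 1}. \<forall>t\<in>T. \<exists>u.
    is_the_solution (\<lambda>v. nd v k) (sqrt (((r t)\<^sup>2 + 1) / (\<alpha>\<^sup>2 + 1))) k u \<and>
    t = t0 + \<sigma> * ((\<alpha>\<^sup>2 + 1) / ((1 - k\<^sup>2) * sqrt (\<bar>A\<bar> * (\<beta>\<^sup>2 + 1))) *
      (jacobi_E u k - k\<^sup>2 * (sn u k * cd u k)))"
proof -
  define n where "n = \<alpha>\<^sup>2 + 1"
  define b where "b = \<beta>\<^sup>2 + 1"
  define e where "e = \<beta>\<^sup>2 - \<alpha>\<^sup>2"
  have nbe: "n > 0" "b > 0" "e > 0"
    using \<alpha>\<beta> by (auto simp: n_def b_def e_def add_nonneg_pos)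
  have k': "1 - k\<^sup>2 = n / b" by (simp add: k(3) n_def b_def)
  have k'_pos: "1 - k\<^sup>2 > 0" unfolding k' using nbe by simp
  have "e / b = 1 - n / b" using nbe(2) by (simp add: n_def b_def e_def field_simps)
  then have k2: "k\<^sup>2 = e / b" using k' by simp
  define c where "c = n / ((1 - k\<^sup>2) * sqrt (\<bar>A\<bar> * b))"
  have Ab: "0 < \<bar>A\<bar> * b" using A nbe by (intro mult_pos_pos) auto
  have c_pos: "c > 0"
    unfolding c_def by (intro divide_pos_pos mult_pos_pos real_sqrt_gt_zero nbe k'_pos Ab)
  have "x / (z * s) * z = x / s" if "z > 0" for x z s :: real using that by simp
  from this[OF k'_pos] have "c * (1 - k\<^sup>2) = n / sqrt (\<bar>A\<bar> * b)" unfolding c_def .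
  then have c: "(c * (1 - k\<^sup>2))\<^sup>2 = n\<^sup>2 / (\<bar>A\<bar> * b)"
    using Ab by (simp add: power_divide)
  define p where "p = b / e"
  define q where "q = - (\<alpha>\<^sup>2 * b / e)"
  define \<phi> where "\<phi> t = amplitude p q (r t)" for t
  define G where "G = (\<lambda>\<phi>. c * (ellE \<phi> k - k\<^sup>2 * (sin \<phi> * (cos \<phi> / sqrt (1 - k\<^sup>2 * (sin \<phi>)\<^sup>2)))))"
  define g where "g = (\<lambda>\<phi>. c * ((1 - k\<^sup>2) / (sqrt (1 - k\<^sup>2 * (sin \<phi>)\<^sup>2)) ^ 3))"
  have f: "A * x ^ 4 + B * x\<^sup>2 + C = \<bar>A\<bar> * ((x\<^sup>2 - \<alpha>\<^sup>2) * (\<beta>\<^sup>2 - x\<^sup>2))" for x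
    using A by (simp add: BC) algebra
  have between: "\<alpha>\<^sup>2 < (r t)\<^sup>2" "(r t)\<^sup>2 < \<beta>\<^sup>2" if "t \<in> T" for t
  proof -
    have "0 < \<bar>A\<bar> * (((r t)\<^sup>2 - \<alpha>\<^sup>2) * (\<beta>\<^sup>2 - (r t)\<^sup>2))"
      using quartic_pos[OF that] unfolding f .
    then have "0 < ((r t)\<^sup>2 - \<alpha>\<^sup>2) * (\<beta>\<^sup>2 - (r t)\<^sup>2)"
      by (rule zero_less_mult_pos) (use A in simp)
    then show "\<alpha>\<^sup>2 < (r t)\<^sup>2" "(r t)\<^sup>2 < \<beta>\<^sup>2"
      using \<alpha>\<beta> by (auto simp: zero_less_mult_iff)
  qed
  have S: "p * x\<^sup>2 + q = b * (x\<^sup>2 - \<alpha>\<^sup>2) / e" for x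
    by (simp add: p_def q_def diff_divide_distrib algebra_simps)
  have S': "1 + x\<^sup>2 - (p * x\<^sup>2 + q) = n * (\<beta>\<^sup>2 - x\<^sup>2) / e" for x
    unfolding S using nbe(3) by (simp add: field_simps) (simp add: n_def b_def e_def algebra_simps)
  have bounds: "0 < p * (r t)\<^sup>2 + q" "p * (r t)\<^sup>2 + q < 1 + (r t)\<^sup>2" if "t \<in> T" for t
  proof -
    show "0 < p * (r t)\<^sup>2 + q" unfolding S using nbe between[OF that] by simp
    have "0 < 1 + (r t)\<^sup>2 - (p * (r t)\<^sup>2 + q)" unfolding S' using nbe between[OF that] by simp
    then show "p * (r t)\<^sup>2 + q < 1 + (r t)\<^sup>2" by simp
  qed
  have dn: "1 - k\<^sup>2 * (sin (amplitude p q (r t)))\<^sup>2 = n / (1 + (r t)\<^sup>2)" if "t \<in> T" for t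
  proof -
    have w: "1 + (r t)\<^sup>2 > 0" by (simp add: add_pos_nonneg)
    have "1 - k\<^sup>2 * (sin (amplitude p q (r t)))\<^sup>2 = 1 - ((r t)\<^sup>2 - \<alpha>\<^sup>2) / (1 + (r t)\<^sup>2)"
      unfolding amplitude_props(3)[OF bounds[OF that]] S k2 using nbe by simp
    also have "\<dots> = n / (1 + (r t)\<^sup>2)" using w by (simp add: n_def field_simps)
    finally show ?thesis .
  qed
  have pq: "p - q = b * n / e" by (simp add: p_def q_def n_def add_divide_distrib algebra_simps)
  have "\<exists>t0. \<exists>\<sigma>\<in>{1, - 1}. \<forall>t\<in>T. t = t0 + \<sigma> * G (amplitude p q (r t))"
  proof (rule elliptic_time_law[where g = g, OF _ bounds])
    have "b * n / e > 0" using nbe by simp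
    then show "p \<noteq> q" using pq by auto
  next
    fix x :: real assume x: "0 < x" "x < pi / 2"
    show "(G has_real_derivative g x) (at x)"
      unfolding G_def g_def by (intro DERIV_cmult DERIV_nd_squared_primitive k)
    show "0 < g x"
      unfolding g_def using c_pos k'_pos Delta_pos[OF k(1,2)] by simp
  next
    fix t assume t: "t \<in> T"
    define x w V where "x = r t" and "w = 1 + x\<^sup>2" and "V = (v t)\<^sup>2"
    have w: "w > 0" by (simp add: w_def add_pos_nonneg)
    have d: "1 - k\<^sup>2 * (sin (amplitude p q x))\<^sup>2 = n / w" using dn[OF t] by (simp add: x_def w_def)
    have V: "x\<^sup>2 * w * V = \<bar>A\<bar> * ((x\<^sup>2 - \<alpha>\<^sup>2) * (\<beta>\<^sup>2 - x\<^sup>2))"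
      using energy[OF t] f[of x] by (simp add: quartic_def x_def w_def V_def)
    have "(sqrt (n / w) ^ 3)\<^sup>2 = (n / w) ^ 3"
    proof -
      have "(sqrt (n / w) ^ 3)\<^sup>2 = ((sqrt (n / w))\<^sup>2) ^ 3" by (simp flip: power_mult)
      then show ?thesis using nbe w by simp
    qed
    then have "(g (amplitude p q x))\<^sup>2 = (c * (1 - k\<^sup>2))\<^sup>2 / (n / w) ^ 3"
      unfolding g_def d by (simp add: power_mult_distrib power_divide)
    also have "\<dots> = w ^ 3 / (\<bar>A\<bar> * b * n)"
      unfolding c using nbe by (simp add: field_simps power2_eq_square power3_eq_cube)
    finally have "(g (amplitude p q x))\<^sup>2 * (p - q)\<^sup>2 * x\<^sup>2 * V
       = (p - q)\<^sup>2 / (\<bar>A\<bar> * b * n) * w\<^sup>2 * (x\<^sup>2 * w * V)"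
      by (simp add: power2_eq_square power3_eq_cube)
    also have "\<dots> = b * (x\<^sup>2 - \<alpha>\<^sup>2) / e * (n * (\<beta>\<^sup>2 - x\<^sup>2) / e) * w\<^sup>2"
      unfolding V pq using A nbe by (simp add: power_divide power_mult_distrib power2_eq_square[of b]
        power2_eq_square[of n] power2_eq_square[of e])
    also have "\<dots> = (p * x\<^sup>2 + q) * (w - (p * x\<^sup>2 + q)) * w\<^sup>2"
      unfolding w_def S' unfolding S ..
    finally show "(g (amplitude p q (r t)))\<^sup>2 * (p - q)\<^sup>2 * (r t)\<^sup>2 * (v t)\<^sup>2
       = (p * (r t)\<^sup>2 + q) * (1 + (r t)\<^sup>2 - (p * (r t)\<^sup>2 + q)) * (1 + (r t)\<^sup>2)\<^sup>2"
      unfolding x_def w_def V_def .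
  qed
  then obtain t0 \<sigma> where \<sigma>: "\<sigma> \<in> {1, -1}" and time: "\<And>t. t \<in> T \<Longrightarrow> t = t0 + \<sigma> * G (\<phi> t)"
    unfolding \<phi>_def by blast
  have "\<exists>u. is_the_solution (\<lambda>v. nd v k) (sqrt (((r t)\<^sup>2 + 1) / n)) k u \<and>
      t = t0 + \<sigma> * (c * (jacobi_E u k - k\<^sup>2 * (sn u k * cd u k)))" if t: "t \<in> T" for t
  proof (intro exI conjI)
    note amp = amplitude_props[OF bounds[OF t], folded \<phi>_def]
    show "is_the_solution (\<lambda>v. nd v k) (sqrt (((r t)\<^sup>2 + 1) / n)) k (ellF (\<phi> t) k)"
    proof (rule is_the_solution_ellF[OF k(1,2) amp(1,2)])
      fix \<psi> :: real
      have D: "0 < sqrt (1 - k\<^sup>2 * (sin \<psi>)\<^sup>2)" using Delta_pos[OF k(1,2)] by simp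
      have "nd (ellF \<psi> k) k = sqrt (((r t)\<^sup>2 + 1) / n) \<longleftrightarrow>
          1 - k\<^sup>2 * (sin \<psi>)\<^sup>2 = 1 - k\<^sup>2 * (sin (\<phi> t))\<^sup>2"
        unfolding nd_def jacobi_at_ellF[OF k(1,2)] inverse_eq_sqrt_iff[OF D] dn[OF t, folded \<phi>_def]
        using Delta_pos[OF k(1,2), of \<psi>] by (simp add: add.commute)
      also have "\<dots> \<longleftrightarrow> (sin \<psi>)\<^sup>2 = (sin (\<phi> t))\<^sup>2"
        using k2 nbe by auto
      finally show "nd (ellF \<psi> k) k = sqrt (((r t)\<^sup>2 + 1) / n) \<longleftrightarrow> (sin \<psi>)\<^sup>2 = (sin (\<phi> t))\<^sup>2" .
    qed
    show "t = t0 + \<sigma> * (c * (jacobi_E (ellF (\<phi> t) k) k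
        - k\<^sup>2 * (sn (ellF (\<phi> t) k) k * cd (ellF (\<phi> t) k) k)))"
      using time[OF t] by (simp add: G_def cd_def jacobi_at_ellF[OF k(1,2)])
  qed
  with \<sigma> show ?thesis unfolding c_def n_def b_def by blast
qed

end

section \<open>The roots determine the coefficients\<close>

text \<open>The quartic is a quadratic in the square of its variable, so a root of each kind fixes both of its zeros,
  \<open>\<alpha>\<^sup>2\<close> and \<open>- \<beta>\<^sup>2\<close>, and these differ because \<open>\<alpha> > 0\<close>. The coefficients are then given by Vieta's formulas.\<close>

lemma coefficients_of_real_and_imaginary_roots:
  fixes A B C \<alpha> \<beta> :: real
  assumes "0 < \<alpha>" "quartic A B C \<alpha> = 0" "quartic A B C (\<i> * of_real \<beta> :: complex) = 0"
  shows "B = A * (\<beta>\<^sup>2 - \<alpha>\<^sup>2)" "C = - (A * \<alpha>\<^sup>2 * \<beta>\<^sup>2)"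
proof -
  have \<alpha>: "A * (\<alpha>\<^sup>2)\<^sup>2 + B * \<alpha>\<^sup>2 + C = 0"
    using assms(2) by (simp add: quartic_def flip: power_mult)
  have "quartic A B C (\<i> * of_real \<beta> :: complex) = of_real (A * (\<beta>\<^sup>2)\<^sup>2 - B * \<beta>\<^sup>2 + C)"
    by (simp add: quartic_def power_mult_distrib flip: power_mult)
  then have "A * (\<beta>\<^sup>2)\<^sup>2 - B * \<beta>\<^sup>2 + C = 0"
    using assms(3) by (metis of_real_eq_0_iff)
  then have "(\<alpha>\<^sup>2 + \<beta>\<^sup>2) * (A * (\<alpha>\<^sup>2 - \<beta>\<^sup>2) + B) = 0" using \<alpha> by algebra
  moreover have "\<alpha>\<^sup>2 + \<beta>\<^sup>2 > 0" using assms(1) by (simp add: add_pos_nonneg)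
  ultimately have "A * (\<alpha>\<^sup>2 - \<beta>\<^sup>2) + B = 0"
    by (metis less_irrefl mult_eq_0_iff)
  then show "B = A * (\<beta>\<^sup>2 - \<alpha>\<^sup>2)" by (simp add: algebra_simps)
  then show "C = - (A * \<alpha>\<^sup>2 * \<beta>\<^sup>2)" using \<alpha> by algebra
qed

lemma coefficients_of_real_roots:
  fixes A B C \<alpha> \<beta> :: real
  assumes "\<alpha>\<^sup>2 < \<beta>\<^sup>2" "quartic A B C \<alpha> = 0" "quartic A B C \<beta> = 0"
  shows "B = - (A * (\<alpha>\<^sup>2 + \<beta>\<^sup>2))" "C = A * \<alpha>\<^sup>2 * \<beta>\<^sup>2"
proof -
  have \<alpha>: "A * (\<alpha>\<^sup>2)\<^sup>2 + B * \<alpha>\<^sup>2 + C = 0" and "A * (\<beta>\<^sup>2)\<^sup>2 + B * \<beta>\<^sup>2 + C = 0"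
    using assms(2,3) by (simp_all add: quartic_def flip: power_mult)
  then have "(\<beta>\<^sup>2 - \<alpha>\<^sup>2) * (A * (\<alpha>\<^sup>2 + \<beta>\<^sup>2) + B) = 0" by algebra
  then have "A * (\<alpha>\<^sup>2 + \<beta>\<^sup>2) + B = 0" using assms(1) by simp
  then show "B = - (A * (\<alpha>\<^sup>2 + \<beta>\<^sup>2))" by simp
  then show "C = A * \<alpha>\<^sup>2 * \<beta>\<^sup>2" using \<alpha> by algebra
qed

lemma modulus_exists:
  fixes m :: real
  assumes "0 \<le> m" "m < 1"
  obtains k where "k \<in> {0..<1}" "k\<^sup>2 = m"
  using assms by (intro that[of "sqrt m"]) auto

lemma compl_modulus_squared:
  assumes "0 \<le> k" "k < 1"
  shows "(compl_modulus k)\<^sup>2 = 1 - k\<^sup>2"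
  using assms by (simp add: compl_modulus_def abs_square_le_1)

section \<open>The time law of a solution\<close>

theorem theorem3p2:
  fixes C0 C1 C2 C3 A B C :: real
    and \<gamma> :: "real \<Rightarrow> point"
    and r :: "real \<Rightarrow> real"
    and J T :: "real set"
  assumes C0: "C0 \<noteq> 0"
    and J: "open J" "is_interval J"
    and sol: "hamiltonian_solution C0 J \<gamma>"
    and I1: "\<And>t. t \<in> J \<Longrightarrow> integral1 (\<gamma> t) = C1"
    and I2: "\<And>t. t \<in> J \<Longrightarrow> integral2 C0 (\<gamma> t) = C2"
    and I3: "\<And>t. t \<in> J \<Longrightarrow> integral3 C0 (\<gamma> t) = C3"
    and I4: "\<And>t. t \<in> J \<Longrightarrow> integral4 (\<gamma> t) = 1 / 2"
    and A: "A = 1 - C0\<^sup>2 / 4"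
    and B: "B = 1 - C1 + (C2 + C3) * C0"
    and C: "C = - C1 - (C2 + C3)\<^sup>2"
    and r: "r = (\<lambda>t. \<gamma> t $ Rad)"
    and T: "is_interval T" "T \<subseteq> J"
    and rdot: "\<And>t. t \<in> T \<Longrightarrow> deriv r t \<noteq> 0"
  shows
    "(A = 0 \<longrightarrow>
       (let a = - C / B in
        \<exists>t0. \<exists>\<sigma>\<in>{1, - 1}. \<forall>t\<in>T.
         t = t0 + \<sigma> * ((1 + a) / sqrt B *
           (1 / 2 * sqrt ((1 + (r t)\<^sup>2) / (1 + a)) * sqrt (((r t)\<^sup>2 - a) / (1 + a))
            + 1 / 2 * ln (sqrt ((1 + (r t)\<^sup>2) / (1 + a)) + sqrt (((r t)\<^sup>2 - a) / (1 + a))))))) \<and>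
     (0 < A \<and> A < 1 \<and> C = 0 \<longrightarrow>
       (let k = sqrt (1 - A) in
       \<exists>t0. \<exists>\<sigma>\<in>{1, - 1}. \<forall>t\<in>T. \<exists>u \<phi>.
         is_the_solution (\<lambda>v. sc v k) (r t) k u \<and> \<phi> = am u k \<and>
         t = t0 + \<sigma> * ellF \<phi> k + \<sigma> * (1 / A * (dn u k * sc u k - jacobi_E u k)))) \<and>
     (\<forall>\<alpha>. 0 < A \<and> A < 1 \<and> C < 0 \<and>
          quartic A B C \<i> = 0 \<and> quartic A B C (- \<i>) = 0 \<and>
          0 < \<alpha> \<and> {x::real. quartic A B C x = 0} = {\<alpha>, - \<alpha>} \<longrightarrow>
       (\<exists>t0. \<exists>\<sigma>\<in>{1, - 1}. \<forall>t\<in>T.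
         t = t0 + \<sigma> * sqrt (((r t)\<^sup>2 - \<alpha>\<^sup>2) / A))) \<and>
     (\<forall>\<alpha> \<beta>. 0 < A \<and> A < 1 \<and> C < 0 \<and>
          0 < \<alpha> \<and> {x::real. quartic A B C x = 0} = {\<alpha>, - \<alpha>} \<and>
          0 < \<beta> \<and> {z::complex. quartic A B C z = 0 \<and> z \<notin> \<real>} = {\<i> * of_real \<beta>, - \<i> * of_real \<beta>} \<and>
          \<beta>\<^sup>2 < 1 \<longrightarrow>
       (\<exists>k\<in>{0..<1}. k\<^sup>2 = (1 - \<beta>\<^sup>2) / (\<alpha>\<^sup>2 + 1) \<and>
        (\<exists>t0. \<exists>\<sigma>\<in>{1, - 1}. \<forall>t\<in>T. \<exists>u.
          is_the_solution (\<lambda>v. ns v k) (sqrt (((r t)\<^sup>2 + 1) / (\<alpha>\<^sup>2 + 1))) k u \<and>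
          t = t0 + \<sigma> * (sqrt (\<alpha>\<^sup>2 + 1) / sqrt A * (u - jacobi_E u k - dn u k * cs u k))))) \<and>
     (\<forall>\<alpha> \<beta>. 0 < A \<and> A < 1 \<and> C < 0 \<and>
          0 < \<alpha> \<and> {x::real. quartic A B C x = 0} = {\<alpha>, - \<alpha>} \<and>
          0 < \<beta> \<and> {z::complex. quartic A B C z = 0 \<and> z \<notin> \<real>} = {\<i> * of_real \<beta>, - \<i> * of_real \<beta>} \<and>
          \<beta>\<^sup>2 > 1 \<longrightarrow>
       (\<exists>k\<in>{0..<1}. (compl_modulus k)\<^sup>2 = (\<alpha>\<^sup>2 + 1) / (\<alpha>\<^sup>2 + \<beta>\<^sup>2) \<and>
        (\<exists>t0. \<exists>\<sigma>\<in>{1, - 1}. \<forall>t\<in>T. \<exists>u.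
          is_the_solution (\<lambda>v. nc v k) (sqrt (((r t)\<^sup>2 + 1) / (\<alpha>\<^sup>2 + 1))) k u \<and>
          t = t0 + \<sigma> * ((\<alpha>\<^sup>2 + 1) / ((compl_modulus k)\<^sup>2 * sqrt (A * (\<alpha>\<^sup>2 + \<beta>\<^sup>2))) *
            ((compl_modulus k)\<^sup>2 * u - jacobi_E u k + dn u k * sc u k))))) \<and>
     (\<forall>\<alpha> \<beta>. A < 0 \<and> 0 \<le> \<alpha> \<and> \<alpha> < \<beta> \<and>
          {x::real. quartic A B C x = 0} = {\<alpha>, - \<alpha>, \<beta>, - \<beta>} \<longrightarrow>
       (\<exists>k\<in>{0..<1}. (compl_modulus k)\<^sup>2 = (\<alpha>\<^sup>2 + 1) / (\<beta>\<^sup>2 + 1) \<and>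
        (\<exists>t0. \<exists>\<sigma>\<in>{1, - 1}. \<forall>t\<in>T. \<exists>u.
          is_the_solution (\<lambda>v. nd v k) (sqrt (((r t)\<^sup>2 + 1) / (\<alpha>\<^sup>2 + 1))) k u \<and>
          t = t0 + \<sigma> * ((\<alpha>\<^sup>2 + 1) / ((compl_modulus k)\<^sup>2 * sqrt (\<bar>A\<bar> * (\<beta>\<^sup>2 + 1))) *
            (jacobi_E u k - k\<^sup>2 * (sn u k * cd u k))))))"
proof -
  have phase: "\<gamma> t \<in> phase_space" if "t \<in> J" for t
    using sol that by (simp add: hamiltonian_solution_def)
  have deriv: "((\<lambda>s. \<gamma> s $ i) has_real_derivative poisson C0 (\<lambda>x. x $ i) hamiltonian (\<gamma> t)) (at t)"
    if "t \<in> J" for t i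
    using sol that by (simp add: hamiltonian_solution_def)
  have dr: "(r has_real_derivative \<gamma> t $ PRad) (at t)" if "t \<in> J" for t
    using deriv[OF that, of Rad] by (simp add: r poisson_Rad_hamiltonian)
  interpret motion: radial_motion T r "\<lambda>t. \<gamma> t $ PRad" A B C
  proof
    show "is_interval T" by (rule T)
    show "continuous_on T (\<lambda>t. \<gamma> t $ PRad)"
      using deriv T(2) by (meson DERIV_isCont continuous_at_imp_continuous_on subsetD)
    fix t assume t: "t \<in> T"
    then have tJ: "t \<in> J" using T(2) by blast
    show "(r has_real_derivative \<gamma> t $ PRad) (at t)" by (rule dr[OF tJ])
    then show "\<gamma> t $ PRad \<noteq> 0" using rdot[OF t] DERIV_imp_deriv by metis
    show "0 < r t" using phase[OF tJ] by (simp add: r phase_space_def)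
    show "(r t)\<^sup>2 * (1 + (r t)\<^sup>2) * (\<gamma> t $ PRad)\<^sup>2 = quartic A B C (r t)"
      using radial_equation[OF phase[OF tJ] I4[OF tJ], of C0]
      unfolding I1[OF tJ] I2[OF tJ] I3[OF tJ] by (simp add: r A B C)
  qed
  have C1: "0 \<le> C1" if "J \<noteq> {}"
    using that phase integral1_nonneg I1 by fastforce
  show ?thesis
  proof (intro conjI impI allI)
    assume "A = 0"
    show "let a = - C / B in
        \<exists>t0. \<exists>\<sigma>\<in>{1, - 1}. \<forall>t\<in>T.
         t = t0 + \<sigma> * ((1 + a) / sqrt B *
           (1 / 2 * sqrt ((1 + (r t)\<^sup>2) / (1 + a)) * sqrt (((r t)\<^sup>2 - a) / (1 + a))
            + 1 / 2 * ln (sqrt ((1 + (r t)\<^sup>2) / (1 + a)) + sqrt (((r t)\<^sup>2 - a) / (1 + a)))))"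
    proof (cases "T = {}")
      case True
      then show ?thesis by (auto simp: Let_def)
    next
      case False
      then have "0 \<le> C1" using C1 T(2) by blast
      then have "C \<le> 0" unfolding C using zero_le_power2[of "C2 + C3"] by linarith
      then show ?thesis unfolding Let_def by (rule motion.time_law_degenerate[OF \<open>A = 0\<close>])
    qed
  next
    assume asm: "0 < A \<and> A < 1 \<and> C = 0"
    show "let k = sqrt (1 - A) in
       \<exists>t0. \<exists>\<sigma>\<in>{1, - 1}. \<forall>t\<in>T. \<exists>u \<phi>.
         is_the_solution (\<lambda>v. sc v k) (r t) k u \<and> \<phi> = am u k \<and>
         t = t0 + \<sigma> * ellF \<phi> k + \<sigma> * (1 / A * (dn u k * sc u k - jacobi_E u k))"
    proof (cases "T = {}")
      case True
      then show ?thesis by (auto simp: Let_def)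
    next
      case False
      then have "0 \<le> C1" using C1 T(2) by blast
      moreover have "C1 + (C2 + C3)\<^sup>2 = 0" using asm C by simp
      ultimately have "C1 = 0" "(C2 + C3)\<^sup>2 = 0" using zero_le_power2[of "C2 + C3"] by linarith+
      then have "C1 = 0" "C2 + C3 = 0" by simp_all
      then have "B = 1" unfolding B by simp
      then show ?thesis using asm unfolding Let_def by (intro motion.time_law_double_root_zero) auto
    qed
  next
    fix \<alpha> assume asm: "0 < A \<and> A < 1 \<and> C < 0 \<and>
      quartic A B C \<i> = 0 \<and> quartic A B C (- \<i>) = 0 \<and>
      0 < \<alpha> \<and> {x::real. quartic A B C x = 0} = {\<alpha>, - \<alpha>}"
    then have "quartic A B C \<alpha> = 0" "quartic A B C (\<i> * of_real 1 :: complex) = 0" by auto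
    from coefficients_of_real_and_imaginary_roots[OF _ this] asm
    show "\<exists>t0. \<exists>\<sigma>\<in>{1, - 1}. \<forall>t\<in>T. t = t0 + \<sigma> * sqrt (((r t)\<^sup>2 - \<alpha>\<^sup>2) / A)"
      by (intro motion.time_law_unit_imaginary_roots) auto
  next
    fix \<alpha> \<beta> assume asm: "0 < A \<and> A < 1 \<and> C < 0 \<and>
      0 < \<alpha> \<and> {x::real. quartic A B C x = 0} = {\<alpha>, - \<alpha>} \<and>
      0 < \<beta> \<and> {z::complex. quartic A B C z = 0 \<and> z \<notin> \<real>} = {\<i> * of_real \<beta>, - \<i> * of_real \<beta>} \<and>
      \<beta>\<^sup>2 < 1"
    then have "0 < \<alpha>" "quartic A B C \<alpha> = 0" "quartic A B C (\<i> * of_real \<beta> :: complex) = 0" by blast+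
    note BC = coefficients_of_real_and_imaginary_roots[OF this]
    have "0 < \<beta>\<^sup>2" using asm by simp
    then have "0 < \<alpha>\<^sup>2 + 1" "1 - \<beta>\<^sup>2 < \<alpha>\<^sup>2 + 1" using zero_le_power2[of \<alpha>] by linarith+
    then have "0 \<le> (1 - \<beta>\<^sup>2) / (\<alpha>\<^sup>2 + 1)" "(1 - \<beta>\<^sup>2) / (\<alpha>\<^sup>2 + 1) < 1" using asm by auto
    then obtain k where k: "k \<in> {0..<1}" "k\<^sup>2 = (1 - \<beta>\<^sup>2) / (\<alpha>\<^sup>2 + 1)" by (rule modulus_exists)
    show "\<exists>k\<in>{0..<1}. k\<^sup>2 = (1 - \<beta>\<^sup>2) / (\<alpha>\<^sup>2 + 1) \<and>
        (\<exists>t0. \<exists>\<sigma>\<in>{1, - 1}. \<forall>t\<in>T. \<exists>u.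
          is_the_solution (\<lambda>v. ns v k) (sqrt (((r t)\<^sup>2 + 1) / (\<alpha>\<^sup>2 + 1))) k u \<and>
          t = t0 + \<sigma> * (sqrt (\<alpha>\<^sup>2 + 1) / sqrt A * (u - jacobi_E u k - dn u k * cs u k)))"
      by (rule bexI[OF _ k(1)], intro conjI k(2) motion.time_law_small_imaginary_roots[OF _ _ BC _ _ k(2)])
         (use asm k(1) in auto)
  next
    fix \<alpha> \<beta> assume asm: "0 < A \<and> A < 1 \<and> C < 0 \<and>
      0 < \<alpha> \<and> {x::real. quartic A B C x = 0} = {\<alpha>, - \<alpha>} \<and>
      0 < \<beta> \<and> {z::complex. quartic A B C z = 0 \<and> z \<notin> \<real>} = {\<i> * of_real \<beta>, - \<i> * of_real \<beta>} \<and>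
      \<beta>\<^sup>2 > 1"
    then have "0 < \<alpha>" "quartic A B C \<alpha> = 0" "quartic A B C (\<i> * of_real \<beta> :: complex) = 0" by blast+
    note BC = coefficients_of_real_and_imaginary_roots[OF this]
    have "0 < \<alpha>\<^sup>2 + 1" "\<alpha>\<^sup>2 + 1 < \<alpha>\<^sup>2 + \<beta>\<^sup>2" using asm by (auto simp: add_nonneg_pos)
    then have "0 \<le> 1 - (\<alpha>\<^sup>2 + 1) / (\<alpha>\<^sup>2 + \<beta>\<^sup>2)" "1 - (\<alpha>\<^sup>2 + 1) / (\<alpha>\<^sup>2 + \<beta>\<^sup>2) < 1" by auto
    then obtain k where k: "k \<in> {0..<1}" "k\<^sup>2 = 1 - (\<alpha>\<^sup>2 + 1) / (\<alpha>\<^sup>2 + \<beta>\<^sup>2)"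
      by (rule modulus_exists)
    have k': "(compl_modulus k)\<^sup>2 = 1 - k\<^sup>2" "1 - k\<^sup>2 = (\<alpha>\<^sup>2 + 1) / (\<alpha>\<^sup>2 + \<beta>\<^sup>2)"
      using k by (auto simp: compl_modulus_squared)
    show "\<exists>k\<in>{0..<1}. (compl_modulus k)\<^sup>2 = (\<alpha>\<^sup>2 + 1) / (\<alpha>\<^sup>2 + \<beta>\<^sup>2) \<and>
        (\<exists>t0. \<exists>\<sigma>\<in>{1, - 1}. \<forall>t\<in>T. \<exists>u.
          is_the_solution (\<lambda>v. nc v k) (sqrt (((r t)\<^sup>2 + 1) / (\<alpha>\<^sup>2 + 1))) k u \<and>
          t = t0 + \<sigma> * ((\<alpha>\<^sup>2 + 1) / ((compl_modulus k)\<^sup>2 * sqrt (A * (\<alpha>\<^sup>2 + \<beta>\<^sup>2))) *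
            ((compl_modulus k)\<^sup>2 * u - jacobi_E u k + dn u k * sc u k)))"
      by (rule bexI[OF _ k(1)], unfold k'(1), intro conjI k'(2) motion.time_law_large_imaginary_roots[OF _ _ BC _ _ k'(2)])
         (use asm k(1) in auto)
  next
    fix \<alpha> \<beta> assume asm: "A < 0 \<and> 0 \<le> \<alpha> \<and> \<alpha> < \<beta> \<and>
      {x::real. quartic A B C x = 0} = {\<alpha>, - \<alpha>, \<beta>, - \<beta>}"
    have \<alpha>\<beta>: "\<alpha>\<^sup>2 < \<beta>\<^sup>2" using asm by (intro power_strict_mono) auto
    have "quartic A B C \<alpha> = 0" "quartic A B C \<beta> = 0" using asm by blast+
    note BC = coefficients_of_real_roots[OF \<alpha>\<beta> this]
    have "0 < \<alpha>\<^sup>2 + 1" "\<alpha>\<^sup>2 + 1 < \<beta>\<^sup>2 + 1" using \<alpha>\<beta> by (auto simp: add_nonneg_pos)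
    then have "0 \<le> 1 - (\<alpha>\<^sup>2 + 1) / (\<beta>\<^sup>2 + 1)" "1 - (\<alpha>\<^sup>2 + 1) / (\<beta>\<^sup>2 + 1) < 1" by auto
    then obtain k where k: "k \<in> {0..<1}" "k\<^sup>2 = 1 - (\<alpha>\<^sup>2 + 1) / (\<beta>\<^sup>2 + 1)"
      by (rule modulus_exists)
    have k': "(compl_modulus k)\<^sup>2 = 1 - k\<^sup>2" "1 - k\<^sup>2 = (\<alpha>\<^sup>2 + 1) / (\<beta>\<^sup>2 + 1)"
      using k by (auto simp: compl_modulus_squared)
    show "\<exists>k\<in>{0..<1}. (compl_modulus k)\<^sup>2 = (\<alpha>\<^sup>2 + 1) / (\<beta>\<^sup>2 + 1) \<and>
        (\<exists>t0. \<exists>\<sigma>\<in>{1, - 1}. \<forall>t\<in>T. \<exists>u.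
          is_the_solution (\<lambda>v. nd v k) (sqrt (((r t)\<^sup>2 + 1) / (\<alpha>\<^sup>2 + 1))) k u \<and>
          t = t0 + \<sigma> * ((\<alpha>\<^sup>2 + 1) / ((compl_modulus k)\<^sup>2 * sqrt (\<bar>A\<bar> * (\<beta>\<^sup>2 + 1))) *
            (jacobi_E u k - k\<^sup>2 * (sn u k * cd u k))))"
      by (rule bexI[OF _ k(1)], unfold k'(1), intro conjI k'(2) motion.time_law_four_real_roots[OF _ \<alpha>\<beta> BC _ _ k'(2)])
         (use asm k(1) in auto)
  qed
qed

end
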